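(* Let $A, B, C$ be rings, let $f: A\to B$ and $g: A\to C$ be ring homomorphisms, and let $J$ be an ideal of $B$ and $J'$ an ideal of $C$ such that $f^{-1}(J)=g^{-1}(J')=:I_0$. Assume that $A$ is a local ring with maximal ideal $m$, that $J$ is a nonzero proper ideal of $B$, that $J'$ is a nonzero proper ideal of $C$, and that $J\times J'\subseteq \mathrm{Jac}(B\times C)$. Then the following statements hold: (1) If $A\bowtie^{f,g}(J,J')$ is Gaussian, then so are $f(A)+J$ and $g(A)+J'$. (2) If $A$, $f(A)+J$ and $g(A)+J'$ are Gaussian, $J^2=0$, $J'^2=0$, and for every $a\in m$ one has $f(a)J=f(a)^2J$ and $g(a)J'=g(a)^2J'$, then $A\bowtie^{f,g}(J,J')$ is Gaussian. (3) Assume that $A$ is Gaussian, $J^2=0$, $J'^2=0$, and $I_0$ is a prime ideal of $A$. Then $A\bowtie^{f,g}(J,J')$ is Gaussian if and only if $f(A)+J$ and $g(A)+J'$ are Gaussian and for every $a\in m$ one has $f(a)J=f(a)^2J$ and $g(a)J'=g(a)^2J'$.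
   Context: All rings are commutative with identity. A local ring is a ring with a unique maximal ideal (not assumed Noetherian). $\mathrm{Jac}(R)$ denotes the Jacobson radical of a ring $R$. Here $f(A)+J=\{f(a)+j : a\in A, j\in J\}$ is a subring of $B$ and $g(A)+J'=\{g(a)+j' : a\in A, j'\in J'\}$ is a subring of $C$. Bi-amalgamation: for ring homomorphisms $f:A\to B$, $g:A\to C$ and ideals $J\subseteq B$, $J'\subseteq C$ with $f^{-1}(J)=g^{-1}(J')$, the bi-amalgamation of $A$ with $(B,C)$ along $(J,J')$ with respect to $(f,g)$ is the subring of $B\times C$ $$A\bowtie^{f,g}(J,J'):=\{(f(a)+j,\,g(a)+j') : a\in A,\ (j,j')\in J\times J'\}.$$ A ring $R$ is Gaussian if $c(pq)=c(p)c(q)$ for all $p,q\in R[X]$, where the content $c(p)$ is the ideal of $R$ generated by the coefficients of $p$. *)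

theory Defs
  imports
    "HOL-Algebra.Ideal_Product"
    "HOL-Algebra.Chinese_Remainder"
    "HOL-Algebra.UnivPoly"
begin

locale local_ring = cring +
  assumes unique_maximalideal: "\<exists>!M. maximalideal M R"

text \<open>Intersecting with the carrier only matters for the zero ring, which has no maximal ideal.\<close>

definition Jac :: "('a, 'k) ring_scheme \<Rightarrow> 'a set"
  where "Jac R = carrier R \<inter> \<Inter>{M. maximalideal M R}"

definition content :: "('a, 'k) ring_scheme \<Rightarrow> (nat \<Rightarrow> 'a) \<Rightarrow> 'a set"
  where "content R p = Idl\<^bsub>R\<^esub> (range (up_ring.coeff (UP R) p))"

locale gaussian_ring = cring +
  assumes content_mult:
    "\<lbrakk>p \<in> carrier (UP R); q \<in> carrier (UP R)\<rbrakk>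
      \<Longrightarrow> content R (p \<otimes>\<^bsub>UP R\<^esub> q) = ideal_prod R (content R p) (content R q)"

definition image_plus_ideal ::
  "('a, 'k) ring_scheme \<Rightarrow> ('b, 'l) ring_scheme \<Rightarrow> ('a \<Rightarrow> 'b) \<Rightarrow> 'b set \<Rightarrow> ('b, 'l) ring_scheme"
  where "image_plus_ideal A B f J = B\<lparr>carrier := {f a \<oplus>\<^bsub>B\<^esub> j | a j. a \<in> carrier A \<and> j \<in> J}\<rparr>"

definition bi_amalgamation ::
  "('a, 'k) ring_scheme \<Rightarrow> ('b, 'l) ring_scheme \<Rightarrow> ('c, 'm) ring_scheme
    \<Rightarrow> ('a \<Rightarrow> 'b) \<Rightarrow> ('a \<Rightarrow> 'c) \<Rightarrow> 'b set \<Rightarrow> 'c set \<Rightarrow> ('b \<times> 'c) ring"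
  where "bi_amalgamation A B C f g J J' =
    (RDirProd B C)\<lparr>carrier :=
      {(f a \<oplus>\<^bsub>B\<^esub> j, g a \<oplus>\<^bsub>C\<^esub> j') | a j j'. a \<in> carrier A \<and> j \<in> J \<and> j' \<in> J'}\<rparr>"

end

theory Submission
  imports
    Defs
    "HOL-Algebra.Subrings"
    "HOL-Algebra.Ring_Divisibility"
begin

text \<open>A local ring is Gaussian iff for any two elements \<open>a\<close>, \<open>b\<close>, possibly after exchanging them,
  \<open>b = a v + d\<close> with \<open>a d = 0\<close> and \<open>d\<^sup>2 = 0\<close>. If this holds, all coefficients of two polynomials are
  such multiples of a single coefficient \<open>a\<close> up to remainders that are killed by \<open>a\<close> and by each
  other, and the content formula reduces to that for a polynomial with a unit coefficient. Conversely,
  the content formula for a few products of linear polynomials makes \<open>(a, b)\<^sup>2\<close> equal to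
  \<open>(a\<^sup>2)\<close> or \<open>(b\<^sup>2)\<close>. For the bi-amalgamation with \<open>J\<^sup>2 = J'\<^sup>2 = 0\<close>, the decomposition lifts from
  \<open>A\<close> as soon as \<open>f(a)J = f(a)\<^sup>2J\<close> and \<open>g(a)J' = g(a)\<^sup>2J'\<close>; the necessity of these equations follows
  by decomposing the pairs \<open>(f(a), g(a))\<close>, \<open>(j, 0)\<close> and \<open>(f(a), g(a))\<close>, \<open>(0, j')\<close>. Part (1) holds
  because \<open>f(A) + J\<close> and \<open>g(A) + J'\<close> are homomorphic images of the bi-amalgamation.\<close>

section \<open>Content ideals and homomorphic images\<close>

lemma UP_carrier [simp]: "carrier (UP R) = up R"
  by (simp add: UP_def)

lemma UP_coeff: "p \<in> up R \<Longrightarrow> up_ring.coeff (UP R) p = p"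
  by (auto simp: UP_def)

lemma UP_mult:
  "p \<in> up R \<Longrightarrow> q \<in> up R \<Longrightarrow>
    p \<otimes>\<^bsub>UP R\<^esub> q = (\<lambda>n. \<Oplus>\<^bsub>R\<^esub>i\<in>{..n}. p i \<otimes>\<^bsub>R\<^esub> q (n - i))"
  by (simp add: UP_def)

context cring
begin

text \<open>Rewriting with these rules moves every term of an equation to the side where it has positive
  sign; together with associativity and commutativity this decides ring identities.\<close>

lemma add_minus_simps:
  assumes "a \<in> carrier R" "b \<in> carrier R" "c \<in> carrier R"
  shows "a \<oplus> (b \<ominus> c) = (a \<oplus> b) \<ominus> c" "(a \<ominus> b) \<oplus> c = (a \<oplus> c) \<ominus> b"
    "(a \<ominus> b) \<ominus> c = a \<ominus> (b \<oplus> c)" "a \<ominus> (b \<ominus> c) = (a \<oplus> c) \<ominus> b"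
  using assms by (simp_all add: a_minus_def minus_add a_ac)

lemma mult_minus_simps:
  assumes "a \<in> carrier R" "b \<in> carrier R" "c \<in> carrier R"
  shows "a \<otimes> (b \<ominus> c) = a \<otimes> b \<ominus> a \<otimes> c" "(a \<ominus> b) \<otimes> c = a \<otimes> c \<ominus> b \<otimes> c"
  using assms by (simp_all add: a_minus_def l_distr r_distr l_minus r_minus)

lemma a_inv_eq_minus: "a \<in> carrier R \<Longrightarrow> \<ominus> a = \<zero> \<ominus> a"
  by (simp add: a_minus_def)

lemma minus_eq_iff:
  assumes "a \<in> carrier R" "b \<in> carrier R" "c \<in> carrier R"
  shows "a \<ominus> b = c \<longleftrightarrow> a = c \<oplus> b"
proof
  assume "a \<ominus> b = c"
  then have "c \<oplus> b = a \<ominus> b \<oplus> b" by simp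
  then show "a = c \<oplus> b" using assms by (simp add: a_minus_def a_assoc l_neg)
next
  assume "a = c \<oplus> b"
  then show "a \<ominus> b = c" using assms by (simp add: a_minus_def a_assoc r_neg)
qed

lemma eq_minus_iff:
  "\<lbrakk>a \<in> carrier R; b \<in> carrier R; c \<in> carrier R\<rbrakk> \<Longrightarrow> c = a \<ominus> b \<longleftrightarrow> c \<oplus> b = a"
  using minus_eq_iff[of a b c] by auto

lemmas identity_simps = add_minus_simps mult_minus_simps a_inv_eq_minus minus_eq_iff eq_minus_iff
  l_distr r_distr m_ac a_ac

section \<open>Content ideals and membership tests for them\<close>

lemma content_eq: "p \<in> up R \<Longrightarrow> content R p = Idl (range p)"
  by (simp add: content_def UP_coeff)

lemma ideal_content: "p \<in> up R \<Longrightarrow> ideal (content R p) R"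
  unfolding content_eq by (rule genideal_ideal) auto

lemma coeff_in_content: "p \<in> up R \<Longrightarrow> p i \<in> content R p"
  unfolding content_eq using genideal_self[of "range p"] by auto

lemma content_subset: "\<lbrakk>p \<in> up R; ideal I R; \<And>i. p i \<in> I\<rbrakk> \<Longrightarrow> content R p \<subseteq> I"
  unfolding content_eq by (rule genideal_minimal) auto

lemma finsum_in_ideal:
  assumes I: "ideal I R" and "\<And>i. i \<in> S \<Longrightarrow> h i \<in> I"
  shows "finsum R h S \<in> I"
proof -
  interpret ideal I R by (rule I)
  show ?thesis
    using assms(2)
  proof (induction S rule: infinite_finite_induct)
    case (insert x S)
    then have "h \<in> S \<rightarrow> carrier R" "h x \<in> carrier R" using Icarr by auto
    with insert show ?case by (simp add: a_closed)
  qed auto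
qed

lemma ideal_criterion:
  assumes "I \<subseteq> carrier R" "I \<noteq> {}"
    and add: "\<And>x y. \<lbrakk>x \<in> I; y \<in> I\<rbrakk> \<Longrightarrow> x \<oplus> y \<in> I"
    and mult: "\<And>r x. \<lbrakk>r \<in> carrier R; x \<in> I\<rbrakk> \<Longrightarrow> r \<otimes> x \<in> I"
  shows "ideal I R"
proof (rule idealI)
  show "subgroup I (add_monoid R)"
  proof (rule add.subgroupI)
    show "\<ominus> x \<in> I" if "x \<in> I" for x
      using mult[of "\<ominus> \<one>" x] that assms(1) by (auto simp: l_minus)
  qed (use assms in auto)
  show "r \<otimes> x \<in> I" "x \<otimes> r \<in> I" if "x \<in> I" "r \<in> carrier R" for x r
    using that mult[of r x] assms(1) by (auto simp: m_comm)
qed (rule ring_axioms)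

text \<open>Serves to pass from generators to an ideal: if \<open>c\<close> times every coefficient
  of a polynomial lies in \<open>I\<close>, then this ideal contains the whole content.\<close>

lemma colon_ideal:
  assumes "ideal I R" and c: "c \<in> carrier R"
  shows "ideal {x \<in> carrier R. c \<otimes> x \<in> I} R"
proof -
  interpret ideal I R by fact
  show ?thesis
  proof (rule ideal_criterion)
    show "{x \<in> carrier R. c \<otimes> x \<in> I} \<noteq> {}" using c by (auto intro!: exI[of _ \<zero>])
    fix r x assume "x \<in> {x \<in> carrier R. c \<otimes> x \<in> I}" and r: "r \<in> carrier R"
    then show "r \<otimes> x \<in> {x \<in> carrier R. c \<otimes> x \<in> I}"
      using c I_l_closed[of "c \<otimes> x" r] by (auto simp: m_ac)
  qed (use c in \<open>auto simp: r_distr\<close>)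
qed

text \<open>The content of a product always lies in the product of the contents. The reverse
  inclusion only has to be tested on products of generators, which leaves a condition on elements,
  free of ideal products.\<close>

lemma gaussian_ring_iff:
  "gaussian_ring R \<longleftrightarrow>
    (\<forall>p\<in>up R. \<forall>q\<in>up R. \<forall>i j. p i \<otimes> q j \<in> content R (p \<otimes>\<^bsub>UP R\<^esub> q))"
proof
  assume "gaussian_ring R"
  then show "\<forall>p\<in>up R. \<forall>q\<in>up R. \<forall>i j. p i \<otimes> q j \<in> content R (p \<otimes>\<^bsub>UP R\<^esub> q)"
    by (auto simp: gaussian_ring.content_mult coeff_in_content intro: ideal_prod.prod)
next
  assume *: "\<forall>p\<in>up R. \<forall>q\<in>up R. \<forall>i j. p i \<otimes> q j \<in> content R (p \<otimes>\<^bsub>UP R\<^esub> q)"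
  show "gaussian_ring R"
  proof
    fix p q assume "p \<in> carrier (UP R)" "q \<in> carrier (UP R)"
    then have p: "p \<in> up R" and q: "q \<in> up R" by simp_all
    then have pq: "p \<otimes>\<^bsub>UP R\<^esub> q \<in> up R" by (simp add: UP_mult up_mult_closed)
    let ?I = "content R (p \<otimes>\<^bsub>UP R\<^esub> q)"
    interpret I: ideal ?I R using ideal_content[OF pq] .
    show "?I = ideal_prod R (content R p) (content R q)"
    proof
      have "ideal (ideal_prod R (content R p) (content R q)) R"
        using p q by (simp add: ideal_content ideal_prod_is_ideal)
      then show "?I \<subseteq> ideal_prod R (content R p) (content R q)"
        by (intro content_subset pq)
          (auto simp: UP_mult p q coeff_in_content intro!: finsum_in_ideal ideal_prod.prod)
      \<comment> \<open>The two factors are extended from coefficients to arbitrary content elements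
        one after the other, each time through a colon ideal.\<close>
      have 1: "p i \<otimes> y \<in> ?I" if "y \<in> content R q" for i y
      proof -
        have "p i \<in> carrier R" using p by auto
        then have "content R q \<subseteq> {y \<in> carrier R. p i \<otimes> y \<in> ?I}"
          using * p q by (intro content_subset colon_ideal I.is_ideal) auto
        with that show ?thesis by auto
      qed
      have 2: "x \<otimes> y \<in> ?I" if x: "x \<in> content R p" and y: "y \<in> content R q" for x y
      proof -
        have yc: "y \<in> carrier R" using ideal.Icarr[OF ideal_content[OF q] y] .
        then have "content R p \<subseteq> {x \<in> carrier R. y \<otimes> x \<in> ?I}"
          using 1[OF y] p by (intro content_subset colon_ideal I.is_ideal) (auto simp: m_comm mem_upD)
        with x yc show ?thesis by (auto simp: m_comm)
      qed
      show "ideal_prod R (content R p) (content R q) \<subseteq> ?I"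
      proof
        fix z assume "z \<in> ideal_prod R (content R p) (content R q)"
        then show "z \<in> ?I" by induction (auto simp: 2)
      qed
    qed
  qed
qed

end

section \<open>Surjective images of Gaussian rings\<close>

lemma up_lift:
  assumes R: "cring R" and S: "cring S" and h: "h \<in> ring_hom R S"
    and surj: "h ` carrier R = carrier S" and p: "p \<in> up S"
  obtains p' where "p' \<in> up R" "h \<circ> p' = p"
proof -
  interpret ring_hom_cring R S h using R S h by (simp add: ring_hom_cring_def ring_hom_cring_axioms_def)
  obtain n where n: "bound \<zero>\<^bsub>S\<^esub> n p" using p S.bound_upD by blast
  \<comment> \<open>The value zero beyond the bound keeps the support finite; an arbitrary preimage
    of zero might be nonzero there.\<close>
  define p' where "p' i = (if n < i then \<zero>\<^bsub>R\<^esub> else SOME x. x \<in> carrier R \<and> h x = p i)" for i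
  have "\<exists>x. x \<in> carrier R \<and> h x = p i" for i using surj mem_upD[OF p, of i] by (metis imageE)
  then have 1: "(SOME x. x \<in> carrier R \<and> h x = p i) \<in> carrier R \<and> h (SOME x. x \<in> carrier R \<and> h x = p i) = p i" for i
    by (rule someI_ex)
  have "p' \<in> up R" using 1 by (intro mem_upI exI[of _ n]) (auto simp: p'_def)
  moreover have "h \<circ> p' = p" using 1 n by (auto simp: p'_def fun_eq_iff)
  ultimately show ?thesis using that by blast
qed

text \<open>Two polynomials over \<open>S\<close> lift to \<open>R\<close>. The preimage of the
  content of their product is an ideal containing the coefficients of the lifted product, so the
  membership test in \<open>R\<close> maps to the one in \<open>S\<close>.\<close>

lemma gaussian_ring_surj_image:
  assumes gauss: "gaussian_ring R" and S: "cring S" and h: "h \<in> ring_hom R S"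
    and surj: "h ` carrier R = carrier S"
  shows "gaussian_ring S"
proof -
  have R: "cring R" using gauss by (simp add: gaussian_ring_def)
  interpret ring_hom_cring R S h using R S h by (simp add: ring_hom_cring_def ring_hom_cring_axioms_def)
  show ?thesis
    unfolding S.gaussian_ring_iff
  proof (intro ballI allI)
    fix p q i j assume p: "p \<in> up S" and q: "q \<in> up S"
    obtain p' where p': "p' \<in> up R" "h \<circ> p' = p" using up_lift[OF R S h surj p] .
    obtain q' where q': "q' \<in> up R" "h \<circ> q' = q" using up_lift[OF R S h surj q] .
    have pq: "p \<otimes>\<^bsub>UP S\<^esub> q \<in> up S" using p q by (simp add: UP_mult S.up_mult_closed)
    have pq': "p' \<otimes>\<^bsub>UP R\<^esub> q' \<in> up R" using p' q' by (simp add: UP_mult R.up_mult_closed)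
    have coeff: "h ((p' \<otimes>\<^bsub>UP R\<^esub> q') n) = (p \<otimes>\<^bsub>UP S\<^esub> q) n" for n
      using p' q' p q by (auto simp: UP_mult mem_upD Pi_def intro!: S.finsum_cong')
    have "content R (p' \<otimes>\<^bsub>UP R\<^esub> q') \<subseteq> {r \<in> carrier R. h r \<in> content S (p \<otimes>\<^bsub>UP S\<^esub> q)}"
      using pq pq' by (intro R.content_subset ring.ideal_vimage S.ideal_content)
        (auto simp: coeff S.coeff_in_content)
    moreover have "p' i \<otimes>\<^bsub>R\<^esub> q' j \<in> content R (p' \<otimes>\<^bsub>UP R\<^esub> q')"
      using gauss R.gaussian_ring_iff p' q' by blast
    ultimately have "h (p' i \<otimes>\<^bsub>R\<^esub> q' j) \<in> content S (p \<otimes>\<^bsub>UP S\<^esub> q)" by blast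
    then show "p i \<otimes>\<^bsub>S\<^esub> q j \<in> content S (p \<otimes>\<^bsub>UP S\<^esub> q)"
      using p' q' by (auto simp: mem_upD)
  qed
qed

section \<open>A pairwise criterion\<close>

text \<open>If any two elements are comparable in this sense, \<open>a\<close> dominates \<open>b\<close> iff \<open>a\<^sup>2\<close> divides \<open>b\<^sup>2\<close>
  (\<open>dominates_square\<close>, \<open>dominates_if_square\<close>); this is what makes the relation transitive.\<close>

definition dominates :: "('a, 'k) ring_scheme \<Rightarrow> 'a \<Rightarrow> 'a \<Rightarrow> bool"
  where "dominates R a b \<longleftrightarrow> (\<exists>v\<in>carrier R. a \<otimes>\<^bsub>R\<^esub> (b \<ominus>\<^bsub>R\<^esub> a \<otimes>\<^bsub>R\<^esub> v) = \<zero>\<^bsub>R\<^esub> \<and>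
    (b \<ominus>\<^bsub>R\<^esub> a \<otimes>\<^bsub>R\<^esub> v) \<otimes>\<^bsub>R\<^esub> (b \<ominus>\<^bsub>R\<^esub> a \<otimes>\<^bsub>R\<^esub> v) = \<zero>\<^bsub>R\<^esub>)"

context cring
begin

section \<open>The content formula from pairwise domination\<close>

text \<open>Modulo \<open>I\<close>, a polynomial with coefficient \<one> is not a zero divisor. All
  products \<open>u i \<otimes> w j\<close> are shown to lie in \<open>I\<close>, by induction on
  the length bound \<open>N\<close> of \<open>w\<close> and, within it, on \<open>i\<close>; the
  case \<open>i = k\<close> is the claim.\<close>

lemma mult_unit_coeff_in_ideal:
  fixes N :: nat
  assumes I: "ideal I R" and u: "\<And>i. u i \<in> carrier R" and k: "u k = \<one>"
    and w: "\<And>i. w i \<in> carrier R" and N: "\<And>i. N \<le> i \<Longrightarrow> w i = \<zero>"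
    and uw: "\<And>n. (\<Oplus>i\<in>{..n}. u i \<otimes> w (n - i)) \<in> I"
  shows "w j \<in> I"
proof -
  interpret ideal I R by (rule I)
  have "w j \<in> I" using w N uw
  proof (induction N arbitrary: w j rule: nat_induct)
    case 0
    then show ?case by simp
  next
    case (Suc N)
    note wc [simp] = Suc.prems(1) and uc [simp] = u
    have "u i \<otimes> w j \<in> I" for i j
    proof (induction i arbitrary: j rule: less_induct)
      case (less i)
      \<comment> \<open>In coefficient \<open>i\<close> of the product, every term except this one
        is in \<open>I\<close> by the inner induction hypothesis.\<close>
      have uiw0: "u i \<otimes> w 0 \<in> I"
      proof (cases i)
        case 0
        then show ?thesis using Suc.prems(3)[of 0] by simp
      next
        case (Suc i')
        let ?s = "\<Oplus>l\<in>{..i'}. u l \<otimes> w (i - l)"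
        have s: "?s \<in> I" using less.IH Suc by (intro finsum_in_ideal I) auto
        have "u i \<otimes> w 0 \<oplus> ?s \<in> I"
          using Suc.prems(3)[of i] Suc by (simp add: atMost_Suc)
        moreover have "u i \<otimes> w 0 = (u i \<otimes> w 0 \<oplus> ?s) \<ominus> ?s"
          using Icarr[OF s] by (simp add: a_minus_def a_assoc r_neg)
        ultimately show ?thesis
          using s by (metis a_minus_def a_closed a_inv_closed)
      qed
      \<comment> \<open>This is \<open>u i\<close> times \<open>w\<close> with the constant term
        dropped and the rest shifted down, so its bound is \<open>N\<close> and the outer induction
        hypothesis applies.\<close>
      define w' where "w' l = u i \<otimes> w (Suc l)" for l
      have w': "w' l \<in> I" for l
      proof (rule Suc.IH)
        fix n
        let ?s = "\<Oplus>l\<in>{..n}. u l \<otimes> w (Suc n - l)"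
        have sc: "?s \<in> carrier R" by (simp add: finsum_closed)
        have t: "u (Suc n) \<otimes> (u i \<otimes> w 0) \<in> I" using uiw0 by (simp add: I_l_closed)
        have "u i \<otimes> (u (Suc n) \<otimes> w 0 \<oplus> ?s) \<in> I"
          using Suc.prems(3)[of "Suc n"] by (simp add: atMost_Suc I_l_closed)
        moreover have "x \<otimes> s = x \<otimes> (y \<otimes> z \<oplus> s) \<ominus> y \<otimes> (x \<otimes> z)"
          if "x \<in> carrier R" "y \<in> carrier R" "z \<in> carrier R" "s \<in> carrier R" for x y z s
          using that by (simp add: identity_simps)
        from this[OF u u wc sc]
        have "u i \<otimes> ?s = u i \<otimes> (u (Suc n) \<otimes> w 0 \<oplus> ?s) \<ominus> u (Suc n) \<otimes> (u i \<otimes> w 0)" .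
        ultimately have "u i \<otimes> ?s \<in> I"
          using t by (simp only: a_minus_def a_closed a_inv_closed)
        also have "u i \<otimes> ?s = (\<Oplus>l\<in>{..n}. u l \<otimes> w' (n - l))"
          by (subst finsum_rdistr)
            (auto simp: w'_def m_ac Suc_diff_le intro!: finsum_cong')
        finally show "(\<Oplus>l\<in>{..n}. u l \<otimes> w' (n - l)) \<in> I" .
      qed (use Suc.prems in \<open>auto simp: w'_def\<close>)
      show ?case
        using uiw0 w' by (cases j) (auto simp: w'_def)
    qed
    from this[of k j] k show ?case by simp
  qed
  then show ?thesis .
qed

lemma dominates_square:
  assumes "a \<in> carrier R" "b \<in> carrier R" "dominates R a b"
  obtains t where "t \<in> carrier R" "b \<otimes> b = a \<otimes> a \<otimes> t"
proof -
  obtain v where v: "v \<in> carrier R" and 1: "a \<otimes> (b \<ominus> a \<otimes> v) = \<zero>"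
    and 2: "(b \<ominus> a \<otimes> v) \<otimes> (b \<ominus> a \<otimes> v) = \<zero>"
    using assms(3) by (auto simp: dominates_def)
  have "b \<otimes> b = (b \<ominus> a \<otimes> v) \<otimes> (b \<ominus> a \<otimes> v) \<oplus> a \<otimes> (b \<ominus> a \<otimes> v) \<otimes> (v \<oplus> v) \<oplus> a \<otimes> a \<otimes> (v \<otimes> v)"
    using assms v by (simp add: identity_simps)
  also have "\<dots> = a \<otimes> a \<otimes> (v \<otimes> v)" unfolding 1 2 using assms v by simp
  finally show ?thesis using that[of "v \<otimes> v"] v by simp
qed

text \<open>If \<open>b\<close> dominates \<open>a\<close> with multiplier \<open>v\<close>, then a
  b = a^2 t v and a^2 = a^2 t v^2. These two equations make \<open>t \<otimes> v\<close> a
  multiplier for the domination of \<open>b\<close> by \<open>a\<close>.\<close>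

lemma dominates_if_square:
  assumes a: "a \<in> carrier R" and b: "b \<in> carrier R" and t: "t \<in> carrier R"
    and bb: "b \<otimes> b = a \<otimes> a \<otimes> t" and dom: "dominates R a b \<or> dominates R b a"
  shows "dominates R a b"
  using dom
proof
  assume "dominates R b a"
  then obtain v where v: "v \<in> carrier R" and 1: "b \<otimes> (a \<ominus> b \<otimes> v) = \<zero>"
    and 2: "(a \<ominus> b \<otimes> v) \<otimes> (a \<ominus> b \<otimes> v) = \<zero>"
    by (auto simp: dominates_def)
  have ab: "a \<otimes> b = a \<otimes> a \<otimes> (t \<otimes> v)"
  proof -
    have "a \<otimes> b = b \<otimes> (a \<ominus> b \<otimes> v) \<oplus> (b \<otimes> b) \<otimes> v"
      using a b v by (simp add: identity_simps)
    also have "\<dots> = a \<otimes> a \<otimes> (t \<otimes> v)" unfolding 1 bb using a t v by (simp add: m_assoc)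
    finally show ?thesis .
  qed
  have aa: "a \<otimes> a = a \<otimes> a \<otimes> (t \<otimes> (v \<otimes> v))"
  proof -
    have "a \<otimes> a = (a \<ominus> b \<otimes> v) \<otimes> (a \<ominus> b \<otimes> v) \<oplus> b \<otimes> (a \<ominus> b \<otimes> v) \<otimes> (v \<oplus> v) \<oplus> (b \<otimes> b) \<otimes> (v \<otimes> v)"
      using a b v by (simp add: identity_simps)
    also have "\<dots> = a \<otimes> a \<otimes> (t \<otimes> (v \<otimes> v))" unfolding 1 2 bb using a t v by (simp add: m_assoc)
    finally show ?thesis .
  qed
  let ?e = "b \<ominus> a \<otimes> (t \<otimes> v)"
  have ae: "a \<otimes> ?e = \<zero>"
  proof -
    have "a \<otimes> ?e = a \<otimes> b \<ominus> a \<otimes> a \<otimes> (t \<otimes> v)"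
      using a b t v by (simp add: identity_simps)
    then show ?thesis unfolding ab using a t v by (simp add: r_neg a_minus_def)
  qed
  have "?e \<otimes> ?e = b \<otimes> b \<ominus> (t \<otimes> v) \<otimes> (a \<otimes> b) \<ominus> (t \<otimes> v) \<otimes> (a \<otimes> ?e)"
    using a b t v by (simp add: identity_simps)
  also have "\<dots> = a \<otimes> a \<otimes> t \<ominus> (a \<otimes> a \<otimes> (t \<otimes> (v \<otimes> v))) \<otimes> t" unfolding ae bb ab
    using a b t v by (simp add: identity_simps)
  also have "\<dots> = \<zero>" unfolding aa[symmetric]
    using a t by (simp add: identity_simps)
  finally show ?thesis using ae t v by (auto simp: dominates_def)
qed

text \<open>Applied to remainders of different coefficients: they have square zero, and since one of
  them dominates the other, their product vanishes.\<close>

lemma square_zero_mult: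
  assumes "a \<in> carrier R" "b \<in> carrier R" "a \<otimes> a = \<zero>" "dominates R a b"
  shows "a \<otimes> b = \<zero>"
proof -
  obtain v where v: "v \<in> carrier R" and 1: "a \<otimes> (b \<ominus> a \<otimes> v) = \<zero>"
    using assms(4) by (auto simp: dominates_def)
  have "a \<otimes> b = a \<otimes> (b \<ominus> a \<otimes> v) \<oplus> a \<otimes> a \<otimes> v"
    using assms(1,2) v by (simp add: identity_simps)
  then show ?thesis using 1 assms(3) v by simp
qed

text \<open>With a = p k, p i = a (u i) + d and q j = a (w j) + e, every product involving a
  remainder vanishes, so p i q j = (u i) a^2 (w j). Thus the coefficients of the product are those
  of \<open>u\<close> times a^2 \<open>w\<close>, and \<open>u\<close> has coefficient \<one> at
  \<open>k\<close>.\<close>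

lemma gaussian_if_dominates_aux:
  assumes dom: "\<And>a b. \<lbrakk>a \<in> carrier R; b \<in> carrier R\<rbrakk> \<Longrightarrow> dominates R a b \<or> dominates R b a"
    and p: "p \<in> up R" and q: "q \<in> up R"
    and pk: "\<And>i. dominates R (p k) (p i)" and qk: "\<And>i. dominates R (p k) (q i)"
  shows "p i \<otimes> q j \<in> content R (p \<otimes>\<^bsub>UP R\<^esub> q)"
proof -
  note pc [simp] = mem_upD[OF p] and qc [simp] = mem_upD[OF q]
  have pq: "p \<otimes>\<^bsub>UP R\<^esub> q \<in> up R" using p q by (simp add: UP_mult up_mult_closed)
  define a where "a = p k"
  have a [simp]: "a \<in> carrier R" by (simp add: a_def)
  define good where "good b v \<longleftrightarrow> v \<in> carrier R \<and> a \<otimes> (b \<ominus> a \<otimes> v) = \<zero> \<and>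
    (b \<ominus> a \<otimes> v) \<otimes> (b \<ominus> a \<otimes> v) = \<zero>" for b v
  have ex: "\<exists>v. good (p i) v" "\<exists>v. good (q i) v" for i
    using pk[of i] qk[of i] by (auto simp: dominates_def a_def good_def)
  \<comment> \<open>The choice \<one> at \<open>k\<close> is admissible because
    \<open>p k = a\<close>; it supplies the unit coefficient.\<close>
  define u where "u i = (if i = k then \<one> else SOME v. good (p i) v)" for i
  \<comment> \<open>Zero is prescribed where \<open>q\<close> vanishes, so that \<open>w\<close>
    inherits the bound of \<open>q\<close>.\<close>
  define w where "w i = (if q i = \<zero> then \<zero> else SOME v. good (q i) v)" for i
  have u: "good (p i) (u i)" for i
    using someI_ex[OF ex(1)] by (auto simp: u_def) (simp add: good_def a_def r_neg a_minus_def)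
  have w: "good (q i) (w i)" for i
    using someI_ex[OF ex(2)] by (auto simp: w_def) (simp add: good_def a_minus_def)
  have [simp]: "u i \<in> carrier R" "w i \<in> carrier R" for i using u w by (auto simp: good_def)
  have prod: "b \<otimes> c = u' \<otimes> (a \<otimes> a \<otimes> w')"
    if "good b u'" "good c w'" and [simp]: "b \<in> carrier R" "c \<in> carrier R" for b c u' w'
  proof -
    let ?b = "b \<ominus> a \<otimes> u'" and ?c = "c \<ominus> a \<otimes> w'"
    have uw [simp]: "u' \<in> carrier R" "w' \<in> carrier R" using that by (auto simp: good_def)
    have "a \<otimes> ?b = \<zero>" "a \<otimes> ?c = \<zero>" "?b \<otimes> ?b = \<zero>" "?c \<otimes> ?c = \<zero>"
      using that by (auto simp: good_def)
    moreover from this have "?b \<otimes> ?c = \<zero>"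
      using dom[of ?b ?c] square_zero_mult[of ?b ?c] square_zero_mult[of ?c ?b] by (auto simp: m_comm)
    moreover have "b \<otimes> c = u' \<otimes> (a \<otimes> a \<otimes> w') \<oplus> u' \<otimes> (a \<otimes> ?c) \<oplus> w' \<otimes> (a \<otimes> ?b) \<oplus> ?b \<otimes> ?c"
      using a that(3,4) uw by (simp add: identity_simps)
    ultimately show ?thesis by simp
  qed
  have pq_eq: "p i \<otimes> q j = u i \<otimes> (a \<otimes> a \<otimes> w j)" for i j
    using u w by (intro prod) auto
  obtain N where N: "bound \<zero> N q" using q bound_upD by blast
  interpret ideal "content R (p \<otimes>\<^bsub>UP R\<^esub> q)" R using ideal_content[OF pq] .
  have "a \<otimes> a \<otimes> w j \<in> content R (p \<otimes>\<^bsub>UP R\<^esub> q)"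
  proof (rule mult_unit_coeff_in_ideal[where k = k and N = "Suc N" and u = u])
    fix n show "(\<Oplus>i\<in>{..n}. u i \<otimes> (a \<otimes> a \<otimes> w (n - i))) \<in> content R (p \<otimes>\<^bsub>UP R\<^esub> q)"
      using coeff_in_content[OF pq, of n] p q by (simp add: UP_mult pq_eq)
  next
    fix i assume "Suc N \<le> i"
    then show "a \<otimes> a \<otimes> w i = \<zero>" using N by (auto simp: w_def bound_def)
  qed (use u in \<open>auto simp: is_ideal u_def[of k]\<close>)
  then show ?thesis by (simp add: pq_eq I_l_closed)
qed

lemma finite_range_up: "p \<in> up R \<Longrightarrow> finite (range p)"
proof -
  assume "p \<in> up R"
  then obtain n where "bound \<zero> n p" using bound_upD by blast
  then have "p i \<in> insert \<zero> (p ` {..n})" for i by (cases "n < i") (auto simp: bound_def)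
  then have "range p \<subseteq> insert \<zero> (p ` {..n})" by blast
  then show ?thesis by (rule finite_subset) simp
qed

text \<open>Domination is transitive, being divisibility of squares, so among the finitely many
  coefficients of both polynomials one dominates all the others. If it belongs to \<open>q\<close>,
  the factors are exchanged.\<close>

proposition gaussian_if_dominates:
  assumes dom: "\<And>a b. \<lbrakk>a \<in> carrier R; b \<in> carrier R\<rbrakk> \<Longrightarrow> dominates R a b \<or> dominates R b a"
  shows "gaussian_ring R"
  unfolding gaussian_ring_iff
proof (intro ballI allI)
  fix p q i j assume p: "p \<in> up R" and q: "q \<in> up R"
  have trans: "dominates R a c"
    if ab: "dominates R a b" and bc: "dominates R b c"
      and a [simp]: "a \<in> carrier R" and b [simp]: "b \<in> carrier R" and c [simp]: "c \<in> carrier R"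
    for a b c
  proof -
    obtain s where s: "s \<in> carrier R" "b \<otimes> b = a \<otimes> a \<otimes> s" using dominates_square[OF a b ab] .
    obtain t where t: "t \<in> carrier R" "c \<otimes> c = b \<otimes> b \<otimes> t" using dominates_square[OF b c bc] .
    show ?thesis
      using s t by (intro dominates_if_square[of a c "s \<otimes> t"] dom) (auto simp: m_assoc)
  qed
  have "\<exists>a\<in>S. \<forall>b\<in>S. dominates R a b" if "finite S" "S \<noteq> {}" "S \<subseteq> carrier R" for S
    using that
  proof (induction S rule: finite_ne_induct)
    case (singleton x)
    then show ?case using dom[of x x] by auto
  next
    case (insert x S)
    then obtain a where a: "a \<in> S" "\<forall>b\<in>S. dominates R a b" by auto
    then have [simp]: "a \<in> carrier R" "x \<in> carrier R" using insert by auto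
    have xx: "dominates R x x" using dom[of x x] by auto
    from dom[of a x] show ?case
    proof
      assume "dominates R x a"
      then have "\<forall>b\<in>S. dominates R x b" using a insert.prems by (auto intro: trans[of x a])
      with xx show ?thesis by auto
    qed (use a in auto)
  qed
  from this[of "range p \<union> range q"] obtain a where a: "a \<in> range p \<union> range q"
    and *: "\<forall>b\<in>range p \<union> range q. dominates R a b"
    using p q by (auto simp: finite_range_up mem_upD)
  from a show "p i \<otimes> q j \<in> content R (p \<otimes>\<^bsub>UP R\<^esub> q)"
  proof
    assume "a \<in> range p"
    then obtain k where "a = p k" by auto
    then show ?thesis using * by (intro gaussian_if_dominates_aux[OF dom p q]) auto
  next
    assume "a \<in> range q"
    then obtain k where "a = q k" by auto
    then have "q j \<otimes> p i \<in> content R (q \<otimes>\<^bsub>UP R\<^esub> p)"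
      using * by (intro gaussian_if_dominates_aux[OF dom q p]) auto
    moreover have "q \<otimes>\<^bsub>UP R\<^esub> p = p \<otimes>\<^bsub>UP R\<^esub> q"
      using p q UP_cring.UP_m_comm[OF UP_cring.intro[OF cring_axioms]] by simp
    ultimately show ?thesis using p q by (simp add: m_comm mem_upD)
  qed
qed

section \<open>Local Gaussian rings\<close>

text \<open>The polynomials are aX + b and cX + d, and the right-hand side is a general element of
  the ideal generated by the three coefficients of their product. All later uses of the content
  formula in local rings are instances of this relation.\<close>

lemma gaussian_linear:
  assumes gauss: "gaussian_ring R"
    and c [simp]: "a \<in> carrier R" "b \<in> carrier R" "c \<in> carrier R" "d \<in> carrier R"
  obtains x y z where "x \<in> carrier R" "y \<in> carrier R" "z \<in> carrier R"
    "a \<otimes> d = x \<otimes> (a \<otimes> c) \<oplus> y \<otimes> (a \<otimes> d \<oplus> b \<otimes> c) \<oplus> z \<otimes> (b \<otimes> d)"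
proof -
  define p q where "p n = (if n = 0 then b else if n = 1 then a else \<zero>)"
    and "q n = (if n = 0 then d else if n = 1 then c else \<zero>)" for n :: nat
  have p: "p \<in> up R" and q: "q \<in> up R"
    by (intro mem_upI exI[of _ "1::nat"]; auto simp: p_def q_def)+
  note pc [simp] = mem_upD[OF p] and qc [simp] = mem_upD[OF q]
  have pq: "p \<otimes>\<^bsub>UP R\<^esub> q \<in> up R" using p q by (simp add: UP_mult up_mult_closed)
  define I where "I = {x \<otimes> (a \<otimes> c) \<oplus> y \<otimes> (a \<otimes> d \<oplus> b \<otimes> c) \<oplus> z \<otimes> (b \<otimes> d) | x y z.
    x \<in> carrier R \<and> y \<in> carrier R \<and> z \<in> carrier R}"
  have I: "ideal I R"
  proof (rule ideal_criterion)
    show "I \<noteq> {}" using zero_closed unfolding I_def by blast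
    have comb: "\<exists>x'\<in>carrier R. \<exists>y'\<in>carrier R. \<exists>z'\<in>carrier R.
      (x1 \<otimes> u \<oplus> y1 \<otimes> v \<oplus> z1 \<otimes> w) \<oplus> (x2 \<otimes> u \<oplus> y2 \<otimes> v \<oplus> z2 \<otimes> w) = x' \<otimes> u \<oplus> y' \<otimes> v \<oplus> z' \<otimes> w"
      if "x1 \<in> carrier R" "y1 \<in> carrier R" "z1 \<in> carrier R" "x2 \<in> carrier R" "y2 \<in> carrier R"
        "z2 \<in> carrier R" "u \<in> carrier R" "v \<in> carrier R" "w \<in> carrier R" for x1 y1 z1 x2 y2 z2 u v w
      by (rule bexI[of _ "x1 \<oplus> x2"], rule bexI[of _ "y1 \<oplus> y2"], rule bexI[of _ "z1 \<oplus> z2"])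
        (use that in \<open>simp_all add: identity_simps\<close>)
    show "r \<oplus> s \<in> I" if rs: "r \<in> I" "s \<in> I" for r s
    proof -
      obtain x1 y1 z1 where 1: "x1 \<in> carrier R" "y1 \<in> carrier R" "z1 \<in> carrier R"
        "r = x1 \<otimes> (a \<otimes> c) \<oplus> y1 \<otimes> (a \<otimes> d \<oplus> b \<otimes> c) \<oplus> z1 \<otimes> (b \<otimes> d)"
        using rs by (auto simp: I_def)
      obtain x2 y2 z2 where 2: "x2 \<in> carrier R" "y2 \<in> carrier R" "z2 \<in> carrier R"
        "s = x2 \<otimes> (a \<otimes> c) \<oplus> y2 \<otimes> (a \<otimes> d \<oplus> b \<otimes> c) \<oplus> z2 \<otimes> (b \<otimes> d)"
        using rs by (auto simp: I_def)
      have "a \<otimes> c \<in> carrier R" "a \<otimes> d \<oplus> b \<otimes> c \<in> carrier R" "b \<otimes> d \<in> carrier R" by simp_all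
      from comb[OF 1(1-3) 2(1-3) this] show ?thesis unfolding 1(4) 2(4) I_def by blast
    qed
    show "s \<otimes> r \<in> I" if s: "s \<in> carrier R" and r: "r \<in> I" for r s
    proof -
      obtain x y z where 1: "x \<in> carrier R" "y \<in> carrier R" "z \<in> carrier R"
        "r = x \<otimes> (a \<otimes> c) \<oplus> y \<otimes> (a \<otimes> d \<oplus> b \<otimes> c) \<oplus> z \<otimes> (b \<otimes> d)"
        using r by (auto simp: I_def)
      then have "s \<otimes> r = (s \<otimes> x) \<otimes> (a \<otimes> c) \<oplus> (s \<otimes> y) \<otimes> (a \<otimes> d \<oplus> b \<otimes> c) \<oplus> (s \<otimes> z) \<otimes> (b \<otimes> d)"
        using s by (simp add: r_distr m_assoc)
      then show ?thesis using 1 s unfolding I_def by blast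
    qed
  qed (auto simp: I_def)
  interpret I: ideal I R by (rule I)
  have coeffs: "(\<Oplus>i\<in>{..n}. p i \<otimes> q (n - i)) \<in> I" for n
  proof -
    consider "n = 0" | "n = 1" | "n = 2" | "n > 2" by linarith
    then show ?thesis
    proof cases
      case 1
      then have "(\<Oplus>i\<in>{..n}. p i \<otimes> q (n - i)) = \<zero> \<otimes> (a \<otimes> c) \<oplus> \<zero> \<otimes> (a \<otimes> d \<oplus> b \<otimes> c) \<oplus> \<one> \<otimes> (b \<otimes> d)"
        by (simp add: p_def q_def)
      then show ?thesis unfolding I_def by blast
    next
      case 2
      then have "(\<Oplus>i\<in>{..n}. p i \<otimes> q (n - i)) = \<zero> \<otimes> (a \<otimes> c) \<oplus> \<one> \<otimes> (a \<otimes> d \<oplus> b \<otimes> c) \<oplus> \<zero> \<otimes> (b \<otimes> d)"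
        by (simp add: p_def q_def atMost_Suc)
      then show ?thesis unfolding I_def by blast
    next
      case 3
      then have "(\<Oplus>i\<in>{..n}. p i \<otimes> q (n - i)) = \<one> \<otimes> (a \<otimes> c) \<oplus> \<zero> \<otimes> (a \<otimes> d \<oplus> b \<otimes> c) \<oplus> \<zero> \<otimes> (b \<otimes> d)"
        by (simp add: p_def q_def atMost_Suc numeral_2_eq_2)
      then show ?thesis unfolding I_def by blast
    next
      case 4
      then have "p i \<otimes> q (n - i) = \<zero>" if "i \<le> n" for i using that by (auto simp: p_def q_def)
      then show ?thesis by (intro finsum_in_ideal I) auto
    qed
  qed
  have "content R (p \<otimes>\<^bsub>UP R\<^esub> q) \<subseteq> I"
    using coeffs by (intro content_subset pq I) (simp add: UP_mult p q)
  moreover have "p 1 \<otimes> q 0 \<in> content R (p \<otimes>\<^bsub>UP R\<^esub> q)"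
    using gauss p q by (auto simp: gaussian_ring_iff)
  ultimately have "a \<otimes> d \<in> I" by (auto simp: p_def q_def)
  then show ?thesis unfolding I_def mem_Collect_eq by (elim exE conjE) (rule that)
qed

text \<open>The hypotheses say that the square of the ideal (a, b) is generated by a^2. The first
  one makes \<open>a\<close> kill the remainder; that the remainder has square zero requires the
  content formula.\<close>

lemma gaussian_dominates_if_square:
  assumes gauss: "gaussian_ring R"
    and a: "a \<in> carrier R" and b: "b \<in> carrier R" and v: "v \<in> carrier R" and w: "w \<in> carrier R"
    and ab: "a \<otimes> b = a \<otimes> a \<otimes> v" and bb: "b \<otimes> b = a \<otimes> a \<otimes> w"
  shows "dominates R a b"
proof -
  let ?d = "b \<ominus> a \<otimes> v" and ?s = "w \<ominus> v \<otimes> v"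
  have ad: "a \<otimes> ?d = \<zero>"
  proof -
    have "a \<otimes> ?d = a \<otimes> b \<ominus> a \<otimes> a \<otimes> v"
      using a b v by (simp add: identity_simps)
    then show ?thesis unfolding ab using a v by (simp add: r_neg a_minus_def)
  qed
  have dd: "?d \<otimes> ?d = a \<otimes> (a \<otimes> ?s)"
  proof -
    have "?d \<otimes> ?d = b \<otimes> b \<ominus> a \<otimes> b \<otimes> (v \<oplus> v) \<oplus> a \<otimes> a \<otimes> (v \<otimes> v)"
      using a b v by (simp add: identity_simps)
    also have "\<dots> = a \<otimes> (a \<otimes> ?s)" unfolding ab bb
      using a b v w by (simp add: identity_simps)
    finally show ?thesis .
  qed
  \<comment> \<open>The product of \<open>dX + a\<close> and \<open>- a s X + d\<close> is zero, so \<open>d\<^sup>2 = 0\<close>.\<close>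
  have c: "?d \<in> carrier R" "a \<otimes> ?s \<in> carrier R" using a b v w by simp_all
  obtain x y z where xyz: "x \<in> carrier R" "y \<in> carrier R" "z \<in> carrier R"
    "?d \<otimes> ?d = x \<otimes> (?d \<otimes> \<ominus> (a \<otimes> ?s)) \<oplus> y \<otimes> (?d \<otimes> ?d \<oplus> a \<otimes> \<ominus> (a \<otimes> ?s)) \<oplus> z \<otimes> (a \<otimes> ?d)"
    using gaussian_linear[OF gauss c(1) a a_inv_closed[OF c(2)] c(1)] .
  have "?d \<otimes> (a \<otimes> ?s) = \<zero>"
    using m_assoc[OF c(1) a, of ?s] m_comm[OF c(1) a] ad c v w by simp
  then have "?d \<otimes> \<ominus> (a \<otimes> ?s) = \<zero>" using c by (simp add: r_minus)
  moreover have "?d \<otimes> ?d \<oplus> a \<otimes> \<ominus> (a \<otimes> ?s) = \<zero>"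
    unfolding dd using c a by (simp add: r_minus r_neg)
  ultimately have "?d \<otimes> ?d = \<zero>" using xyz ad by simp
  with ad v show ?thesis by (auto simp: dominates_def)
qed

section \<open>Comparing two elements of a local Gaussian ring\<close>

text \<open>Locality is expressed by a proper ideal \<open>M\<close> with only units outside it, a
  form that suits both \<open>A\<close> and the bi-amalgamation. The inverse \<open>e\<close> serves
  to solve equations whose unknown reappears with a coefficient in \<open>M\<close>.\<close>

lemma local_unit:
  assumes "ideal M R" "\<one> \<notin> M" and units: "carrier R - M \<subseteq> Units R"
    and m: "m \<in> M"
  obtains e where "e \<in> carrier R" "e \<otimes> (\<one> \<oplus> m) = \<one>"
proof -
  interpret ideal M R by fact
  have mc [simp]: "m \<in> carrier R" using m Icarr by blast
  have "\<one> \<oplus> m \<notin> M"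
  proof
    assume "\<one> \<oplus> m \<in> M"
    then have "(\<one> \<oplus> m) \<oplus> \<ominus> m \<in> M" using m by simp
    also have "(\<one> \<oplus> m) \<oplus> \<ominus> m = \<one>" by (simp add: a_assoc r_neg)
    finally show False using assms(2) by simp
  qed
  then have "\<one> \<oplus> m \<in> Units R" using units by auto
  then show ?thesis using that by (auto simp: Units_def)
qed

text \<open>The square of the ideal (a, b) is shown to have a single generator \<open>Z\<close>,
  with a^2 = \<alpha> Z and c^2 = (1 - \<alpha>) Z. In a local ring \<alpha> or 1 - \<alpha> is a
  unit, so a^2 or c^2 generates; in the latter case c^2 is a multiple of b^2.\<close>

lemma local_gaussian_dominates_aux:
  assumes gauss: "gaussian_ring R"
    and M: "ideal M R" "\<one> \<notin> M" and units: "carrier R - M \<subseteq> Units R"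
    and a: "a \<in> carrier R" and b: "b \<in> carrier R" and r: "r \<in> carrier R" and s: "s \<in> M"
    and ab: "a \<otimes> b = r \<otimes> (a \<otimes> a) \<oplus> s \<otimes> (b \<otimes> b)"
  shows "dominates R a b \<or> dominates R b a"
proof -
  interpret M: ideal M R by (rule M(1))
  have sc: "s \<in> carrier R" using s M.Icarr by blast
  \<comment> \<open>Replacing \<open>b\<close> by \<open>c\<close> puts both coefficients of the quadratic relation into \<open>M\<close>; then
    \<open>(aX + c)(cX + a)\<close> shows that \<open>(a, c)\<^sup>2\<close> is generated by \<open>Z = a\<^sup>2 + c\<^sup>2\<close>.\<close>
  define c where "c = b \<ominus> r \<otimes> a"
  have c: "c \<in> carrier R" using a b r by (simp add: c_def)
  have b_eq: "b = c \<oplus> r \<otimes> a" unfolding c_def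
    using a b r by (simp add: identity_simps)
  define A2 C2 X where "A2 = a \<otimes> a" and "C2 = c \<otimes> c" and "X = a \<otimes> c"
  have car: "A2 \<in> carrier R" "C2 \<in> carrier R" "X \<in> carrier R" using a c by (simp_all add: A2_def C2_def X_def)
  have ab': "a \<otimes> b = X \<oplus> r \<otimes> A2" unfolding b_eq A2_def X_def
    using a c r by (simp add: identity_simps)
  have bb': "b \<otimes> b = C2 \<oplus> (r \<oplus> r) \<otimes> X \<oplus> r \<otimes> r \<otimes> A2" unfolding b_eq A2_def X_def C2_def
    using a c r by (simp add: identity_simps)
  have X1: "X = s \<otimes> (C2 \<oplus> (r \<oplus> r) \<otimes> X \<oplus> r \<otimes> r \<otimes> A2)"
  proof -
    have "X = (X \<oplus> r \<otimes> A2) \<ominus> r \<otimes> A2"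
      using car r by (simp add: identity_simps)
    also have "\<dots> = (r \<otimes> A2 \<oplus> s \<otimes> (b \<otimes> b)) \<ominus> r \<otimes> A2" using ab unfolding ab' A2_def by simp
    also have "\<dots> = s \<otimes> (C2 \<oplus> (r \<oplus> r) \<otimes> X \<oplus> r \<otimes> r \<otimes> A2)" unfolding bb'
      using car r sc by (simp add: identity_simps)
    finally show ?thesis .
  qed
  \<comment> \<open>In \<open>X1\<close> the unknown \<open>X\<close> occurs on the right with
    coefficient 2 r s in \<open>M\<close>, so the equation can be solved for it.\<close>
  have "\<ominus> (s \<otimes> (r \<oplus> r)) \<in> M" using s r by (simp add: M.I_r_closed)
  then obtain e where e: "e \<in> carrier R" "e \<otimes> (\<one> \<oplus> \<ominus> (s \<otimes> (r \<oplus> r))) = \<one>"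
    using local_unit[OF M units] by blast
  define s1 s2 where "s1 = e \<otimes> s" and "s2 = e \<otimes> s \<otimes> (r \<otimes> r)"
  have sM: "s1 \<in> M" "s2 \<in> M" using s e(1) r by (simp_all add: s1_def s2_def M.I_l_closed M.I_r_closed)
  have s12: "s1 \<in> carrier R" "s2 \<in> carrier R" using sM M.Icarr by blast+
  have X2: "X = s1 \<otimes> C2 \<oplus> s2 \<otimes> A2"
  proof -
    have "X = e \<otimes> (\<one> \<oplus> \<ominus> (s \<otimes> (r \<oplus> r))) \<otimes> X" unfolding e(2) using car by simp
    also have "\<dots> = e \<otimes> (X \<ominus> s \<otimes> (r \<oplus> r) \<otimes> X)"
      using car r sc e(1) by (simp add: identity_simps)
    also have "X \<ominus> s \<otimes> (r \<oplus> r) \<otimes> X = s \<otimes> (C2 \<oplus> (r \<oplus> r) \<otimes> X \<oplus> r \<otimes> r \<otimes> A2) \<ominus> s \<otimes> (r \<oplus> r) \<otimes> X"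
      using X1 by simp
    also have "e \<otimes> \<dots> = s1 \<otimes> C2 \<oplus> s2 \<otimes> A2" unfolding s1_def s2_def
      using car r sc e(1) by (simp add: identity_simps)
    finally show ?thesis .
  qed
  obtain x0 y z0 where xyz: "x0 \<in> carrier R" "y \<in> carrier R" "z0 \<in> carrier R"
    and "a \<otimes> a = x0 \<otimes> (a \<otimes> c) \<oplus> y \<otimes> (a \<otimes> a \<oplus> c \<otimes> c) \<oplus> z0 \<otimes> (c \<otimes> a)"
    using gaussian_linear[OF gauss a c c a] .
  then have A2_eq: "A2 = x0 \<otimes> X \<oplus> y \<otimes> (A2 \<oplus> C2) \<oplus> z0 \<otimes> X"
    using m_comm[OF c a] by (simp add: A2_def C2_def X_def)
  define x Z where "x = x0 \<oplus> z0" and "Z = A2 \<oplus> C2"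
  have xZ: "x \<in> carrier R" "Z \<in> carrier R" using xyz car by (simp_all add: x_def Z_def)
  have A2Z: "A2 = x \<otimes> X \<oplus> y \<otimes> Z"
    unfolding Z_def x_def using A2_eq xyz car by (simp add: l_distr a_ac)
  have C2Z: "C2 = (\<one> \<ominus> y) \<otimes> Z \<ominus> x \<otimes> X"
  proof -
    have "C2 = Z \<ominus> A2" unfolding Z_def using car by (simp add: identity_simps)
    also have "\<dots> = Z \<ominus> (x \<otimes> X \<oplus> y \<otimes> Z)" using A2Z by simp
    also have "\<dots> = (\<one> \<ominus> y) \<otimes> Z \<ominus> x \<otimes> X"
      using car xyz xZ by (simp add: identity_simps)
    finally show ?thesis .
  qed
  \<comment> \<open>Inserting \<open>A2Z\<close> and \<open>C2Z\<close> into \<open>X2\<close> gives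
    (1 + s1 x - s2 x) X = (s1 (1 - y) + s2 y) Z, with a unit on the left; \<rho> is the resulting
    quotient.\<close>
  have "s1 \<otimes> x \<ominus> s2 \<otimes> x \<in> M" unfolding a_minus_def using sM xZ by (simp add: M.I_r_closed)
  then obtain e' where e': "e' \<in> carrier R" "e' \<otimes> (\<one> \<oplus> (s1 \<otimes> x \<ominus> s2 \<otimes> x)) = \<one>"
    using local_unit[OF M units] by blast
  define \<rho> where "\<rho> = e' \<otimes> (s1 \<otimes> (\<one> \<ominus> y) \<oplus> s2 \<otimes> y)"
  have \<rho>: "\<rho> \<in> carrier R" using e' s12 xyz by (simp add: \<rho>_def)
  have XZ: "X = \<rho> \<otimes> Z"
  proof -
    have "X = e' \<otimes> (\<one> \<oplus> (s1 \<otimes> x \<ominus> s2 \<otimes> x)) \<otimes> X" unfolding e'(2) using car by simp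
    also have "\<dots> = e' \<otimes> (X \<oplus> (s1 \<otimes> x \<ominus> s2 \<otimes> x) \<otimes> X)"
      using car s12 xZ e'(1) by (simp add: identity_simps)
    also have "X \<oplus> (s1 \<otimes> x \<ominus> s2 \<otimes> x) \<otimes> X =
      (s1 \<otimes> ((\<one> \<ominus> y) \<otimes> Z \<ominus> x \<otimes> X) \<oplus> s2 \<otimes> (x \<otimes> X \<oplus> y \<otimes> Z)) \<oplus> (s1 \<otimes> x \<ominus> s2 \<otimes> x) \<otimes> X"
      using X2 A2Z C2Z by simp
    also have "e' \<otimes> \<dots> = \<rho> \<otimes> Z" unfolding \<rho>_def
      using car s12 xZ xyz e'(1) by (simp add: identity_simps)
    finally show ?thesis .
  qed
  define \<alpha> where "\<alpha> = x \<otimes> \<rho> \<oplus> y"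
  have \<alpha>: "\<alpha> \<in> carrier R" using xZ \<rho> xyz by (simp add: \<alpha>_def)
  have A2\<alpha>: "A2 = \<alpha> \<otimes> Z"
  proof -
    have "A2 = x \<otimes> (\<rho> \<otimes> Z) \<oplus> y \<otimes> Z" using A2Z XZ by simp
    also have "\<dots> = \<alpha> \<otimes> Z" unfolding \<alpha>_def
      using xZ xyz \<rho> by (simp add: identity_simps)
    finally show ?thesis .
  qed
  have C2\<alpha>: "C2 = (\<one> \<ominus> \<alpha>) \<otimes> Z"
  proof -
    have "C2 = Z \<ominus> A2" unfolding Z_def using car by (simp add: identity_simps)
    also have "\<dots> = Z \<ominus> \<alpha> \<otimes> Z" using A2\<alpha> by simp
    also have "\<dots> = (\<one> \<ominus> \<alpha>) \<otimes> Z"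
      using \<alpha> xZ by (simp add: identity_simps)
    finally show ?thesis .
  qed
  show ?thesis
  proof (cases "\<alpha> \<in> M")
    case False
    then have "\<alpha> \<in> Units R" using units \<alpha> by blast
    then obtain i where i: "i \<in> carrier R" "i \<otimes> \<alpha> = \<one>" by (auto simp: Units_def)
    have Z: "Z = i \<otimes> A2"
      unfolding A2\<alpha> using m_assoc[OF i(1) \<alpha> xZ(2)] i(2) xZ by simp
    have "dominates R a b"
    proof (rule gaussian_dominates_if_square[OF gauss a b])
      have "a \<otimes> b = \<rho> \<otimes> (i \<otimes> A2) \<oplus> r \<otimes> A2" using ab' XZ Z by simp
      also have "\<dots> = A2 \<otimes> (\<rho> \<otimes> i \<oplus> r)"
        using car \<rho> i(1) r by (simp add: identity_simps)
      finally show "a \<otimes> b = a \<otimes> a \<otimes> (\<rho> \<otimes> i \<oplus> r)" unfolding A2_def .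
      have "b \<otimes> b = (\<one> \<ominus> \<alpha>) \<otimes> (i \<otimes> A2) \<oplus> (r \<oplus> r) \<otimes> (\<rho> \<otimes> (i \<otimes> A2)) \<oplus> r \<otimes> r \<otimes> A2"
        using bb' C2\<alpha> XZ Z by simp
      also have "\<dots> = A2 \<otimes> ((\<one> \<ominus> \<alpha>) \<otimes> i \<oplus> (r \<oplus> r) \<otimes> \<rho> \<otimes> i \<oplus> r \<otimes> r)"
        using car \<rho> i(1) r \<alpha> by (simp add: identity_simps)
      finally show "b \<otimes> b = a \<otimes> a \<otimes> ((\<one> \<ominus> \<alpha>) \<otimes> i \<oplus> (r \<oplus> r) \<otimes> \<rho> \<otimes> i \<oplus> r \<otimes> r)"
        unfolding A2_def .
    qed (use \<rho> i(1) r \<alpha> in simp_all)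
    then show ?thesis ..
  next
    \<comment> \<open>Now 1 - \<alpha> is a unit and c^2 generates; a^2 and \<open>X\<close> are
      multiples of it with factors \<kappa> and \<open>l\<close> in \<open>M\<close>.\<close>
    case True
    then have "\<ominus> \<alpha> \<in> M" by simp
    then obtain i where i: "i \<in> carrier R" "i \<otimes> (\<one> \<oplus> \<ominus> \<alpha>) = \<one>"
      using local_unit[OF M units] by blast
    have Z: "Z = i \<otimes> C2"
    proof -
      have "\<one> \<ominus> \<alpha> \<in> carrier R" using \<alpha> by simp
      then show ?thesis
        unfolding C2\<alpha> using m_assoc[OF i(1) _ xZ(2), of "\<one> \<ominus> \<alpha>"] i(2) xZ by (simp add: a_minus_def)
    qed
    define \<kappa> where "\<kappa> = \<alpha> \<otimes> i"
    have \<kappa>M: "\<kappa> \<in> M" using True i(1) by (simp add: \<kappa>_def M.I_r_closed)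
    then have \<kappa>: "\<kappa> \<in> carrier R" using M.Icarr by blast
    have A2\<kappa>: "A2 = \<kappa> \<otimes> C2"
      unfolding \<kappa>_def using A2\<alpha> Z \<alpha> i(1) car by (metis m_assoc)
    define l where "l = s1 \<oplus> s2 \<otimes> \<kappa>"
    have lM: "l \<in> M" using sM \<kappa> by (simp add: l_def M.I_r_closed)
    then have l: "l \<in> carrier R" using M.Icarr by blast
    have Xl: "X = l \<otimes> C2"
    proof -
      have "X = s1 \<otimes> C2 \<oplus> s2 \<otimes> (\<kappa> \<otimes> C2)" using X2 A2\<kappa> by simp
      also have "\<dots> = l \<otimes> C2" unfolding l_def
        using car \<kappa> s12 by (simp add: identity_simps)
      finally show ?thesis .
    qed
    \<comment> \<open>Expanding b = c + r a gives b^2 = (1 + 2 r l + r^2 \<kappa>) c^2 with a unit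
      factor, so c^2 can be replaced by b^2.\<close>
    have "(r \<oplus> r) \<otimes> l \<oplus> r \<otimes> r \<otimes> \<kappa> \<in> M" using lM \<kappa>M r by (simp add: M.I_l_closed)
    then obtain t where t: "t \<in> carrier R" "t \<otimes> (\<one> \<oplus> ((r \<oplus> r) \<otimes> l \<oplus> r \<otimes> r \<otimes> \<kappa>)) = \<one>"
      using local_unit[OF M units] by blast
    have C2b: "C2 = t \<otimes> (b \<otimes> b)"
    proof -
      have "C2 = t \<otimes> (\<one> \<oplus> ((r \<oplus> r) \<otimes> l \<oplus> r \<otimes> r \<otimes> \<kappa>)) \<otimes> C2" unfolding t(2) using car by simp
      also have "\<dots> = t \<otimes> (C2 \<oplus> (r \<oplus> r) \<otimes> (l \<otimes> C2) \<oplus> r \<otimes> r \<otimes> (\<kappa> \<otimes> C2))"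
        using car \<kappa> l r t(1) by (simp add: identity_simps)
      also have "\<dots> = t \<otimes> (b \<otimes> b)" using bb' Xl A2\<kappa> by simp
      finally show ?thesis .
    qed
    have "dominates R b a"
    proof (rule gaussian_dominates_if_square[OF gauss b a])
      have "b \<otimes> a = a \<otimes> b" using a b by (rule m_comm[symmetric])
      also have "\<dots> = l \<otimes> C2 \<oplus> r \<otimes> (\<kappa> \<otimes> C2)" using ab' Xl A2\<kappa> by simp
      also have "\<dots> = C2 \<otimes> (l \<oplus> r \<otimes> \<kappa>)"
        using car \<kappa> l r by (simp add: identity_simps)
      also have "\<dots> = b \<otimes> b \<otimes> (t \<otimes> (l \<oplus> r \<otimes> \<kappa>))"
        unfolding C2b using b \<kappa> l r t(1) by (simp add: identity_simps)
      finally show "b \<otimes> a = b \<otimes> b \<otimes> (t \<otimes> (l \<oplus> r \<otimes> \<kappa>))" .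
      have "a \<otimes> a = \<kappa> \<otimes> C2" using A2\<kappa> unfolding A2_def .
      also have "\<dots> = b \<otimes> b \<otimes> (t \<otimes> \<kappa>)"
        unfolding C2b using b \<kappa> t(1) by (simp add: identity_simps)
      finally show "a \<otimes> a = b \<otimes> b \<otimes> (t \<otimes> \<kappa>)" .
    qed (use \<kappa> l r t(1) in simp_all)
    then show ?thesis ..
  qed
qed

text \<open>The product (aX + b)(aX - b) has no linear term, so the content formula yields a b = r
  a^2 + s b^2. If \<open>r\<close> or \<open>s\<close> lies in \<open>M\<close>, the preceding lemma
  applies, possibly with \<open>a\<close> and \<open>b\<close> exchanged; otherwise both are
  units.\<close>

proposition local_gaussian_dominates:
  assumes gauss: "gaussian_ring R"
    and M: "ideal M R" "\<one> \<notin> M" and units: "carrier R - M \<subseteq> Units R"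
    and a: "a \<in> carrier R" and b: "b \<in> carrier R"
  shows "dominates R a b \<or> dominates R b a"
proof -
  interpret M: ideal M R by (rule M(1))
  note aux = local_gaussian_dominates_aux[OF gauss M units]
  have unit: "\<exists>i\<in>carrier R. i \<otimes> x = \<one>" if "x \<in> carrier R" "x \<notin> M" for x
    using units that by (auto simp: Units_def)
  have nb: "\<ominus> b \<in> carrier R" using b by simp
  obtain x y z where xyz: "x \<in> carrier R" "y \<in> carrier R" "z \<in> carrier R"
    "a \<otimes> \<ominus> b = x \<otimes> (a \<otimes> a) \<oplus> y \<otimes> (a \<otimes> \<ominus> b \<oplus> b \<otimes> a) \<oplus> z \<otimes> (b \<otimes> \<ominus> b)"
    using gaussian_linear[OF gauss a b a nb] .
  define r s where "r = \<ominus> x" and "s = z"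
  have r: "r \<in> carrier R" and s: "s \<in> carrier R" using xyz by (simp_all add: r_def s_def)
  have ab: "a \<otimes> b = r \<otimes> (a \<otimes> a) \<oplus> s \<otimes> (b \<otimes> b)"
  proof -
    have "a \<otimes> b = \<ominus> (a \<otimes> \<ominus> b)" using a b by (simp add: r_minus)
    also have "\<dots> = \<ominus> (x \<otimes> (a \<otimes> a) \<oplus> y \<otimes> (a \<otimes> \<ominus> b \<oplus> b \<otimes> a) \<oplus> z \<otimes> (b \<otimes> \<ominus> b))"
      by (rule arg_cong[OF xyz(4)])
    also have "\<dots> = r \<otimes> (a \<otimes> a) \<oplus> s \<otimes> (b \<otimes> b)" unfolding r_def s_def
      using a b xyz(1-3) by (simp add: identity_simps)
    finally show ?thesis .
  qed
  consider "s \<in> M" | "r \<in> M" | "r \<notin> M" "s \<notin> M" by blast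
  then show ?thesis
  proof cases
    case 1
    then show ?thesis using aux[OF a b r _ ab] by blast
  next
    case 2
    have "b \<otimes> a = s \<otimes> (b \<otimes> b) \<oplus> r \<otimes> (a \<otimes> a)"
      using ab a b r s by (simp add: m_comm a_comm)
    then show ?thesis using aux[OF b a s 2] by blast
  next
    case 3
    obtain r' s' where r': "r' \<in> carrier R" "r' \<otimes> r = \<one>" and s': "s' \<in> carrier R" "s' \<otimes> s = \<one>"
      using 3 unit r s by blast
    \<comment> \<open>\<open>t\<close> is chosen so that \<open>a\<^sup>2 + t b\<^sup>2\<close>, a coefficient of \<open>(aX + b)(t b X + a)\<close>, is a multiple
      of \<open>a b\<close>; hence \<open>(a, b)\<^sup>2\<close> is generated by \<open>a b\<close>.\<close>
    define t where "t = s \<otimes> r'"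
    have t: "t \<in> carrier R" using s r' by (simp add: t_def)
    have tb: "t \<otimes> b \<in> carrier R" using t b by simp
    obtain x y z where xyz: "x \<in> carrier R" "y \<in> carrier R" "z \<in> carrier R"
      "a \<otimes> a = x \<otimes> (a \<otimes> (t \<otimes> b)) \<oplus> y \<otimes> (a \<otimes> a \<oplus> b \<otimes> (t \<otimes> b)) \<oplus> z \<otimes> (b \<otimes> a)"
      using gaussian_linear[OF gauss a b tb a] .
    define X where "X = a \<otimes> b"
    have X: "X \<in> carrier R" using a b by (simp add: X_def)
    have sum: "a \<otimes> a \<oplus> b \<otimes> (t \<otimes> b) = r' \<otimes> X"
    proof -
      have "r' \<otimes> X = (r' \<otimes> r) \<otimes> (a \<otimes> a) \<oplus> b \<otimes> (t \<otimes> b)" unfolding X_def ab t_def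
        using a b r s r'(1) by (simp add: identity_simps)
      then show ?thesis using r'(2) a by simp
    qed
    define \<xi> where "\<xi> = x \<otimes> t \<oplus> y \<otimes> r' \<oplus> z"
    have \<xi>: "\<xi> \<in> carrier R" using xyz t r' by (simp add: \<xi>_def)
    have aa: "a \<otimes> a = \<xi> \<otimes> X"
    proof -
      have "a \<otimes> a = x \<otimes> (a \<otimes> (t \<otimes> b)) \<oplus> y \<otimes> (r' \<otimes> X) \<oplus> z \<otimes> (b \<otimes> a)" using xyz(4) unfolding sum .
      also have "\<dots> = \<xi> \<otimes> X" unfolding \<xi>_def X_def
        using a b r t r'(1) xyz(1-3) by (simp add: identity_simps)
      finally show ?thesis .
    qed
    \<comment> \<open>Obtained by solving a b = r a^2 + s b^2 for b^2 after replacing a^2 by \<xi>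
      X.\<close>
    define \<eta> where "\<eta> = s' \<otimes> (\<one> \<ominus> r \<otimes> \<xi>)"
    have \<eta>: "\<eta> \<in> carrier R" using s' r \<xi> by (simp add: \<eta>_def)
    have bb: "b \<otimes> b = \<eta> \<otimes> X"
    proof -
      have "b \<otimes> b = (s' \<otimes> s) \<otimes> (b \<otimes> b)" using s'(2) b by simp
      also have "\<dots> = s' \<otimes> ((r \<otimes> (a \<otimes> a) \<oplus> s \<otimes> (b \<otimes> b)) \<ominus> r \<otimes> (a \<otimes> a))"
        using a b r s s'(1) by (simp add: identity_simps)
      also have "\<dots> = s' \<otimes> (X \<ominus> r \<otimes> (a \<otimes> a))" by (simp only: X_def ab)
      also have "\<dots> = s' \<otimes> (X \<ominus> r \<otimes> (\<xi> \<otimes> X))" by (simp only: aa)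
      also have "\<dots> = \<eta> \<otimes> X" unfolding \<eta>_def
        using X r \<xi> s'(1) by (simp add: identity_simps)
      finally show ?thesis .
    qed
    \<comment> \<open>If \<xi> or \<eta> is a unit, \<open>X\<close> is a multiple of a^2 or b^2.
      Otherwise X = (r \<xi> + s \<eta>) X with coefficient in \<open>M\<close>, which forces X = 0
      and hence a^2 = b^2 = 0.\<close>
    consider "\<xi> \<notin> M" | "\<eta> \<notin> M" | "\<xi> \<in> M" "\<eta> \<in> M" by blast
    then show ?thesis
    proof cases
      case 1
      then obtain i where i: "i \<in> carrier R" "i \<otimes> \<xi> = \<one>" using unit \<xi> by blast
      have X_eq: "X = a \<otimes> a \<otimes> i"
      proof -
        have "\<xi> \<otimes> X \<otimes> i = i \<otimes> \<xi> \<otimes> X"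
          using X \<xi> i(1) by (simp add: identity_simps)
        then show ?thesis unfolding aa i(2) using X by simp
      qed
      have "dominates R a b"
      proof (rule gaussian_dominates_if_square[OF gauss a b])
        show "a \<otimes> b = a \<otimes> a \<otimes> i" using X_eq unfolding X_def .
        have "\<eta> \<otimes> X = a \<otimes> a \<otimes> (\<eta> \<otimes> i)" unfolding X_eq
          using a i(1) \<eta> by (simp add: identity_simps)
        then show "b \<otimes> b = a \<otimes> a \<otimes> (\<eta> \<otimes> i)" using bb by simp
      qed (use i \<eta> in simp_all)
      then show ?thesis ..
    next
      case 2
      then obtain i where i: "i \<in> carrier R" "i \<otimes> \<eta> = \<one>" using unit \<eta> by blast
      have X_eq: "X = b \<otimes> b \<otimes> i"
      proof -
        have "\<eta> \<otimes> X \<otimes> i = i \<otimes> \<eta> \<otimes> X"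
          using X \<eta> i(1) by (simp add: identity_simps)
        then show ?thesis unfolding bb i(2) using X by simp
      qed
      have "dominates R b a"
      proof (rule gaussian_dominates_if_square[OF gauss b a])
        show "b \<otimes> a = b \<otimes> b \<otimes> i" using X_eq a b unfolding X_def by (simp add: m_comm)
        have "\<xi> \<otimes> X = b \<otimes> b \<otimes> (\<xi> \<otimes> i)" unfolding X_eq
          using b i(1) \<xi> by (simp add: identity_simps)
        then show "a \<otimes> a = b \<otimes> b \<otimes> (\<xi> \<otimes> i)" using aa by simp
      qed (use i \<xi> in simp_all)
      then show ?thesis ..
    next
      case 3
      then have "\<ominus> (r \<otimes> \<xi> \<oplus> s \<otimes> \<eta>) \<in> M" using r s by (simp add: M.I_l_closed)
      then obtain i where i: "i \<in> carrier R" "i \<otimes> (\<one> \<oplus> \<ominus> (r \<otimes> \<xi> \<oplus> s \<otimes> \<eta>)) = \<one>"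
        using local_unit[OF M units] by blast
      have X_eq: "X = r \<otimes> (\<xi> \<otimes> X) \<oplus> s \<otimes> (\<eta> \<otimes> X)" using ab unfolding aa bb X_def .
      have "X = i \<otimes> (X \<ominus> (r \<otimes> (\<xi> \<otimes> X) \<oplus> s \<otimes> (\<eta> \<otimes> X)))"
      proof -
        have "X = i \<otimes> (\<one> \<oplus> \<ominus> (r \<otimes> \<xi> \<oplus> s \<otimes> \<eta>)) \<otimes> X" using i X by simp
        also have "\<dots> = i \<otimes> (X \<ominus> (r \<otimes> (\<xi> \<otimes> X) \<oplus> s \<otimes> (\<eta> \<otimes> X)))"
          using X r s \<xi> \<eta> i(1) by (simp add: identity_simps)
        finally show ?thesis .
      qed
      then have "X = i \<otimes> (X \<ominus> X)" by (simp only: X_eq[symmetric])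
      then have X0: "X = \<zero>" using X i(1) by (simp add: a_minus_def r_neg)
      have "dominates R a b"
        using aa bb X0 \<xi> \<eta> a b by (intro gaussian_dominates_if_square[OF gauss a b, of \<zero> \<zero>]) (simp_all add: X_def)
      then show ?thesis ..
    qed
  qed
qed

end

section \<open>Maximal ideals and units of a local ring\<close>

text \<open>Zorn's lemma for the ideals containing \<open>I\<close>; properness, stated as
  \<open>\<one> \<notin> N\<close>, is preserved by unions of chains.\<close>

lemma (in ring) exists_maximalideal:
  assumes I: "ideal I R" and proper: "I \<noteq> carrier R"
  obtains M where "maximalideal M R" "I \<subseteq> M"
proof -
  let ?S = "{N. ideal N R \<and> I \<subseteq> N \<and> \<one> \<notin> N}"
  have one: "\<one> \<notin> N \<longleftrightarrow> N \<noteq> carrier R" if "ideal N R" for N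
    using ideal.one_imp_carrier[OF that] by auto
  have "\<exists>M\<in>?S. \<forall>X\<in>?S. M \<subseteq> X \<longrightarrow> X = M"
  proof (rule subset_Zorn)
    fix C assume C: "subset.chain ?S C"
    show "\<exists>U\<in>?S. \<forall>X\<in>C. X \<subseteq> U"
    proof (cases "C = {}")
      \<comment> \<open>The union of the empty chain is not an ideal, so \<open>I\<close> itself
        serves as the bound.\<close>
      case True
      then show ?thesis using I proper one by auto
    next
      case False
      have "subset.chain {N. ideal N R} C" using C by (auto simp: subset.chain_def)
      from chain_Union_is_ideal[OF this] have "ideal (\<Union>C) R" using False by simp
      then show ?thesis using C False by (intro bexI[of _ "\<Union>C"]) (auto simp: subset.chain_def)
    qed
  qed
  then obtain M where M: "ideal M R" "I \<subseteq> M" "\<one> \<notin> M"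
    and max: "\<And>X. \<lbrakk>ideal X R; I \<subseteq> X; \<one> \<notin> X; M \<subseteq> X\<rbrakk> \<Longrightarrow> X = M" by auto
  have "maximalideal M R"
  proof (rule maximalidealI)
    fix N assume N: "ideal N R" "M \<subseteq> N"
    show "N = M \<or> N = carrier R"
    proof (cases "\<one> \<in> N")
      case False
      then show ?thesis using max[OF N(1) _ False N(2)] M(2) N(2) by simp
    qed (use one[OF N(1)] in simp)
  qed (use M one in auto)
  then show ?thesis using that M by blast
qed

text \<open>A nonunit generates a proper ideal; this lies in a maximal ideal, which must be
  \<open>m\<close> by uniqueness.\<close>

lemma (in local_ring) Units_if_notin_maximalideal:
  assumes "maximalideal m R" "x \<in> carrier R" "x \<notin> m"
  shows "x \<in> Units R"
proof (rule ccontr)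
  assume x: "x \<notin> Units R"
  have "\<one> \<notin> PIdl x"
    using x assms(2) by (auto simp: cgenideal_def Units_def) (metis m_comm)
  then have "PIdl x \<noteq> carrier R" by blast
  then obtain M where "maximalideal M R" "PIdl x \<subseteq> M"
    using exists_maximalideal[OF cgenideal_ideal[OF assms(2)]] by blast
  then show False using unique_maximalideal assms cgenideal_self[OF assms(2)] by blast
qed

section \<open>Bi-amalgamations\<close>

text \<open>The element of \<open>A\<close> is an argument because a pair belongs to the
  bi-amalgamation exactly when both components lie over a common one.\<close>

definition lies_over ::
  "('a, 'k) ring_scheme \<Rightarrow> ('b, 'l) ring_scheme \<Rightarrow> ('a \<Rightarrow> 'b) \<Rightarrow> 'b set \<Rightarrow> 'a \<Rightarrow> 'b \<Rightarrow> bool"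
  where "lies_over A B f J a x \<longleftrightarrow> a \<in> carrier A \<and> x \<in> carrier B \<and> x \<ominus>\<^bsub>B\<^esub> f a \<in> J"

locale hom_ideal = ring_hom_cring A B f + J: ideal J B
  for A :: "('a, 'k) ring_scheme" and B :: "('b, 'l) ring_scheme" and f :: "'a \<Rightarrow> 'b"
    and J :: "'b set"
begin

abbreviation "over \<equiv> lies_over A B f J"

lemma over_carrier: "over a x \<Longrightarrow> a \<in> carrier A \<and> x \<in> carrier B"
  by (simp add: lies_over_def)

lemma over_iff: "over a x \<longleftrightarrow> a \<in> carrier A \<and> (\<exists>j\<in>J. x = f a \<oplus>\<^bsub>B\<^esub> j)"
proof
  assume "over a x"
  then have "a \<in> carrier A" "x \<in> carrier B" "x \<ominus>\<^bsub>B\<^esub> f a \<in> J" by (auto simp: lies_over_def)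
  moreover from this have "x = f a \<oplus>\<^bsub>B\<^esub> (x \<ominus>\<^bsub>B\<^esub> f a)"
    by (simp add: a_minus_def S.a_lcomm S.r_neg)
  ultimately show "a \<in> carrier A \<and> (\<exists>j\<in>J. x = f a \<oplus>\<^bsub>B\<^esub> j)" by blast
next
  assume "a \<in> carrier A \<and> (\<exists>j\<in>J. x = f a \<oplus>\<^bsub>B\<^esub> j)"
  then obtain j where a: "a \<in> carrier A" and j: "j \<in> J" "x = f a \<oplus>\<^bsub>B\<^esub> j" by blast
  have jc: "j \<in> carrier B" using j J.Icarr by blast
  then have "x \<ominus>\<^bsub>B\<^esub> f a = j"
    using a j by (simp add: a_minus_def S.a_comm[of "f a" j] S.a_assoc S.r_neg)
  then show "over a x" using a j jc by (simp add: lies_over_def)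
qed

lemma over_hom: "a \<in> carrier A \<Longrightarrow> over a (f a)"
  by (simp add: lies_over_def a_minus_def S.r_neg)

lemma over_ideal: "j \<in> J \<Longrightarrow> over \<zero>\<^bsub>A\<^esub> j"
  using J.Icarr by (simp add: lies_over_def a_minus_def)

lemma over_one: "over \<one>\<^bsub>A\<^esub> \<one>\<^bsub>B\<^esub>"
  using over_hom[of "\<one>\<^bsub>A\<^esub>"] by simp

lemma over_add:
  assumes "over a x" "over b y"
  shows "over (a \<oplus>\<^bsub>A\<^esub> b) (x \<oplus>\<^bsub>B\<^esub> y)"
proof -
  have eq: "(x \<oplus>\<^bsub>B\<^esub> y) \<ominus>\<^bsub>B\<^esub> (u \<oplus>\<^bsub>B\<^esub> w) = (x \<ominus>\<^bsub>B\<^esub> u) \<oplus>\<^bsub>B\<^esub> (y \<ominus>\<^bsub>B\<^esub> w)"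
    if "x \<in> carrier B" "y \<in> carrier B" "u \<in> carrier B" "w \<in> carrier B" for x y u w
    using that by (simp add: S.identity_simps)
  show ?thesis using assms by (simp add: lies_over_def eq)
qed

lemma over_mult:
  assumes "over a x" "over b y"
  shows "over (a \<otimes>\<^bsub>A\<^esub> b) (x \<otimes>\<^bsub>B\<^esub> y)"
proof -
  have eq: "(x \<otimes>\<^bsub>B\<^esub> y) \<ominus>\<^bsub>B\<^esub> (u \<otimes>\<^bsub>B\<^esub> w) = x \<otimes>\<^bsub>B\<^esub> (y \<ominus>\<^bsub>B\<^esub> w) \<oplus>\<^bsub>B\<^esub> (x \<ominus>\<^bsub>B\<^esub> u) \<otimes>\<^bsub>B\<^esub> w"
    if "x \<in> carrier B" "y \<in> carrier B" "u \<in> carrier B" "w \<in> carrier B" for x y u w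
    using that by (simp add: S.identity_simps)
  show ?thesis using assms by (simp add: lies_over_def eq J.I_l_closed J.I_r_closed)
qed

lemma over_a_inv:
  assumes "over a x"
  shows "over (\<ominus>\<^bsub>A\<^esub> a) (\<ominus>\<^bsub>B\<^esub> x)"
proof -
  have "\<ominus>\<^bsub>B\<^esub> x \<ominus>\<^bsub>B\<^esub> \<ominus>\<^bsub>B\<^esub> f a = \<ominus>\<^bsub>B\<^esub> (x \<ominus>\<^bsub>B\<^esub> f a)"
    using assms by (simp add: lies_over_def a_minus_def S.minus_add)
  then show ?thesis using assms by (simp add: lies_over_def)
qed

lemma carrier_image_plus_ideal: "carrier (image_plus_ideal A B f J) = {x. \<exists>a. over a x}"
  by (auto simp: image_plus_ideal_def over_iff)

lemma cring_image_plus_ideal: "cring (image_plus_ideal A B f J)"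
proof -
  let ?H = "{x. \<exists>a. over a x}"
  have H: "?H \<subseteq> carrier B" using over_carrier by blast
  have "subring ?H B"
  proof (rule S.subringI[OF H])
    show "\<one>\<^bsub>B\<^esub> \<in> ?H" using over_one by blast
    show "\<ominus>\<^bsub>B\<^esub> h \<in> ?H" if "h \<in> ?H" for h using that over_a_inv by blast
    show "h \<otimes>\<^bsub>B\<^esub> h' \<in> ?H" if "h \<in> ?H" "h' \<in> ?H" for h h' using that over_mult by blast
    show "h \<oplus>\<^bsub>B\<^esub> h' \<in> ?H" if "h \<in> ?H" "h' \<in> ?H" for h h' using that over_add by blast
  qed
  then have "cring (B\<lparr>carrier := ?H\<rparr>)"
    using S.subcring_iff[OF H] S.subcringI' by simp
  then show ?thesis
    using carrier_image_plus_ideal by (simp add: image_plus_ideal_def)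
qed

text \<open>Any \<open>x\<close> over \<open>a\<close> differs from \<open>f a\<close> by an element
  of \<open>J\<close>. Together with the equality of the preimages this carries membership from one
  component to the other.\<close>

lemma mem_ideal_iff:
  assumes "over a x"
  shows "x \<in> J \<longleftrightarrow> f a \<in> J"
proof -
  obtain j where j: "j \<in> J" "x = f a \<oplus>\<^bsub>B\<^esub> j" and a: "a \<in> carrier A" using assms over_iff by blast
  have "f a = x \<ominus>\<^bsub>B\<^esub> j" using j a J.Icarr by (simp add: a_minus_def S.a_assoc S.r_neg)
  then show ?thesis using j by (metis J.a_closed J.a_inv_closed a_minus_def)
qed

lemma over_inverse:
  assumes J2: "\<And>j k. \<lbrakk>j \<in> J; k \<in> J\<rbrakk> \<Longrightarrow> j \<otimes>\<^bsub>B\<^esub> k = \<zero>\<^bsub>B\<^esub>"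
    and x: "over a x" and c: "c \<in> carrier A" and ac: "a \<otimes>\<^bsub>A\<^esub> c = \<one>\<^bsub>A\<^esub>"
  obtains x' where "over c x'" "x \<otimes>\<^bsub>B\<^esub> x' = \<one>\<^bsub>B\<^esub>"
proof -
  obtain j where j: "j \<in> J" "x = f a \<oplus>\<^bsub>B\<^esub> j" and a: "a \<in> carrier A" using x over_iff by blast
  define F G where "F = f a" and "G = f c"
  have car: "F \<in> carrier B" "G \<in> carrier B" "j \<in> carrier B"
    using a c j J.Icarr by (simp_all add: F_def G_def)
  have FG: "F \<otimes>\<^bsub>B\<^esub> G = \<one>\<^bsub>B\<^esub>" using a c ac by (simp add: F_def G_def flip: hom_mult)
  \<comment> \<open>G - G^2 j is the first-order expansion of the inverse of F + j, which is exact
    since products of elements of \<open>J\<close> vanish.\<close>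
  let ?k = "\<ominus>\<^bsub>B\<^esub> (G \<otimes>\<^bsub>B\<^esub> G \<otimes>\<^bsub>B\<^esub> j)"
  have k: "?k \<in> J" using j car by (simp add: J.I_l_closed)
  have "(F \<oplus>\<^bsub>B\<^esub> j) \<otimes>\<^bsub>B\<^esub> (G \<oplus>\<^bsub>B\<^esub> ?k) =
    F \<otimes>\<^bsub>B\<^esub> G \<oplus>\<^bsub>B\<^esub> (\<one>\<^bsub>B\<^esub> \<ominus>\<^bsub>B\<^esub> F \<otimes>\<^bsub>B\<^esub> G) \<otimes>\<^bsub>B\<^esub> (G \<otimes>\<^bsub>B\<^esub> j) \<oplus>\<^bsub>B\<^esub> j \<otimes>\<^bsub>B\<^esub> ?k"
    using car by (simp add: S.identity_simps)
  also have "\<dots> = \<one>\<^bsub>B\<^esub>" using J2[OF j(1) k] FG car by (simp add: a_minus_def S.r_neg)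
  finally have "x \<otimes>\<^bsub>B\<^esub> (f c \<oplus>\<^bsub>B\<^esub> ?k) = \<one>\<^bsub>B\<^esub>" using j by (simp add: F_def G_def)
  moreover have "over c (f c \<oplus>\<^bsub>B\<^esub> ?k)" using c k over_iff by blast
  ultimately show ?thesis using that by blast
qed

text \<open>A multiplier over the same \<open>v\<close> is produced, so that the lifts to
  \<open>B\<close> and \<open>C\<close> fit together into one element of the
  bi-amalgamation.\<close>

lemma dominates_lift:
  assumes J2: "\<And>j k. \<lbrakk>j \<in> J; k \<in> J\<rbrakk> \<Longrightarrow> j \<otimes>\<^bsub>B\<^esub> k = \<zero>\<^bsub>B\<^esub>"
    and absorb: "\<And>a j. \<lbrakk>a \<in> carrier A; j \<in> J\<rbrakk> \<Longrightarrow> \<exists>k\<in>J. f a \<otimes>\<^bsub>B\<^esub> j = f a \<otimes>\<^bsub>B\<^esub> (f a \<otimes>\<^bsub>B\<^esub> k)"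
    and x: "over a x" and y: "over b y" and v: "v \<in> carrier A"
    and ad: "a \<otimes>\<^bsub>A\<^esub> (b \<ominus>\<^bsub>A\<^esub> a \<otimes>\<^bsub>A\<^esub> v) = \<zero>\<^bsub>A\<^esub>"
    and dd: "(b \<ominus>\<^bsub>A\<^esub> a \<otimes>\<^bsub>A\<^esub> v) \<otimes>\<^bsub>A\<^esub> (b \<ominus>\<^bsub>A\<^esub> a \<otimes>\<^bsub>A\<^esub> v) = \<zero>\<^bsub>A\<^esub>"
  shows "\<exists>w. over v w \<and> x \<otimes>\<^bsub>B\<^esub> (y \<ominus>\<^bsub>B\<^esub> x \<otimes>\<^bsub>B\<^esub> w) = \<zero>\<^bsub>B\<^esub> \<and>
    (y \<ominus>\<^bsub>B\<^esub> x \<otimes>\<^bsub>B\<^esub> w) \<otimes>\<^bsub>B\<^esub> (y \<ominus>\<^bsub>B\<^esub> x \<otimes>\<^bsub>B\<^esub> w) = \<zero>\<^bsub>B\<^esub>"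
proof -
  obtain j where j: "j \<in> J" "x = f a \<oplus>\<^bsub>B\<^esub> j" and a: "a \<in> carrier A" using x over_iff by blast
  obtain i where i: "i \<in> J" "y = f b \<oplus>\<^bsub>B\<^esub> i" and b: "b \<in> carrier A" using y over_iff by blast
  define d where "d = b \<ominus>\<^bsub>A\<^esub> a \<otimes>\<^bsub>A\<^esub> v"
  have d: "d \<in> carrier A" using a b v by (simp add: d_def)
  define F D V where "F = f a" and "D = f d" and "V = f v"
  have [simp]: "F \<in> carrier B" "D \<in> carrier B" "V \<in> carrier B"
    using a d v by (simp_all add: F_def D_def V_def)
  have b_eq: "b = a \<otimes>\<^bsub>A\<^esub> v \<oplus>\<^bsub>A\<^esub> d" unfolding d_def
    using a b v by (simp add: R.identity_simps)
  have fb: "f b = F \<otimes>\<^bsub>B\<^esub> V \<oplus>\<^bsub>B\<^esub> D" unfolding b_eq F_def D_def V_def using a v d by simp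
  have FD: "F \<otimes>\<^bsub>B\<^esub> D = \<zero>\<^bsub>B\<^esub>" using ad a d by (simp add: F_def D_def flip: hom_mult d_def)
  have DD: "D \<otimes>\<^bsub>B\<^esub> D = \<zero>\<^bsub>B\<^esub>" using dd d by (simp add: D_def flip: hom_mult d_def)
  have [simp]: "j \<in> carrier B" "i \<in> carrier B" using i j J.Icarr by blast+
  \<comment> \<open>Absorption for \<open>d\<close> turns D k into D^2 l, which is zero.\<close>
  have DJ: "D \<otimes>\<^bsub>B\<^esub> k = \<zero>\<^bsub>B\<^esub>" if k: "k \<in> J" for k
  proof -
    obtain l where l: "l \<in> J" "D \<otimes>\<^bsub>B\<^esub> k = D \<otimes>\<^bsub>B\<^esub> (D \<otimes>\<^bsub>B\<^esub> l)" using absorb[OF d k] by (auto simp: D_def)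
    then show ?thesis using DD J.Icarr[OF l(1)] by (simp flip: S.m_assoc)
  qed
  \<comment> \<open>The naive multiplier \<open>V\<close> leaves the remainder D + i1.\<close>
  define i1 where "i1 = i \<ominus>\<^bsub>B\<^esub> j \<otimes>\<^bsub>B\<^esub> V"
  have i1: "i1 \<in> J" using i j by (simp add: i1_def a_minus_def J.I_r_closed)
  \<comment> \<open>Correcting \<open>V\<close> by this \<open>k\<close> changes i1 to
    \<open>i2\<close>, and makes \<open>F\<close> kill i1 - F k; the other terms of x (D + i2)
    vanish by F D = 0, D J = 0 and J^2 = 0.\<close>
  obtain k where k: "k \<in> J" "F \<otimes>\<^bsub>B\<^esub> i1 = F \<otimes>\<^bsub>B\<^esub> (F \<otimes>\<^bsub>B\<^esub> k)" using absorb[OF a i1] by (auto simp: F_def)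
  have [simp]: "k \<in> carrier B" "i1 \<in> carrier B" using k i1 J.Icarr by blast+
  define i2 where "i2 = i1 \<ominus>\<^bsub>B\<^esub> (F \<oplus>\<^bsub>B\<^esub> j) \<otimes>\<^bsub>B\<^esub> k"
  have i2: "i2 \<in> J" using i1 k by (simp add: i2_def a_minus_def J.I_l_closed)
  have [simp]: "i2 \<in> carrier B" using i2 J.Icarr by blast
  have rest: "y \<ominus>\<^bsub>B\<^esub> x \<otimes>\<^bsub>B\<^esub> (V \<oplus>\<^bsub>B\<^esub> k) = D \<oplus>\<^bsub>B\<^esub> i2"
    unfolding i j fb F_def[symmetric] i2_def i1_def
    by (simp add: S.identity_simps)
  have "x \<otimes>\<^bsub>B\<^esub> (D \<oplus>\<^bsub>B\<^esub> i2) = F \<otimes>\<^bsub>B\<^esub> D \<oplus>\<^bsub>B\<^esub> (F \<otimes>\<^bsub>B\<^esub> i1 \<ominus>\<^bsub>B\<^esub> F \<otimes>\<^bsub>B\<^esub> (F \<otimes>\<^bsub>B\<^esub> k)) \<ominus>\<^bsub>B\<^esub> F \<otimes>\<^bsub>B\<^esub> (j \<otimes>\<^bsub>B\<^esub> k)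
      \<oplus>\<^bsub>B\<^esub> D \<otimes>\<^bsub>B\<^esub> j \<oplus>\<^bsub>B\<^esub> j \<otimes>\<^bsub>B\<^esub> i2"
    unfolding j F_def[symmetric] i2_def
    by (simp add: S.identity_simps)
  also have "\<dots> = \<zero>\<^bsub>B\<^esub>"
    using FD k DJ[OF j(1)] J2[OF j(1) k(1)] J2[OF j(1) i2] by (simp add: a_minus_def S.r_neg)
  finally have 1: "x \<otimes>\<^bsub>B\<^esub> (D \<oplus>\<^bsub>B\<^esub> i2) = \<zero>\<^bsub>B\<^esub>" .
  have 2: "(D \<oplus>\<^bsub>B\<^esub> i2) \<otimes>\<^bsub>B\<^esub> (D \<oplus>\<^bsub>B\<^esub> i2) = \<zero>\<^bsub>B\<^esub>"
    using DD DJ[OF i2] J2[OF i2 i2] S.m_comm[of i2 D] by (simp add: S.l_distr S.r_distr)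
  have "over v (V \<oplus>\<^bsub>B\<^esub> k)" using v k over_iff by (auto simp: V_def)
  with 1 2 show ?thesis unfolding rest[symmetric] by blast
qed

text \<open>Since f(a) J lies in \<open>J\<close>, the inclusion of f(a)^2 J in f(a) J is automatic;
  the elementwise condition is the other inclusion.\<close>

lemma absorb_iff:
  assumes a: "a \<in> carrier A"
  shows "f a <#\<^bsub>B\<^esub> J = (f a [^]\<^bsub>B\<^esub> (2::nat)) <#\<^bsub>B\<^esub> J \<longleftrightarrow>
    (\<forall>j\<in>J. \<exists>k\<in>J. f a \<otimes>\<^bsub>B\<^esub> j = f a \<otimes>\<^bsub>B\<^esub> (f a \<otimes>\<^bsub>B\<^esub> k))"
proof -
  have sq: "(f a [^]\<^bsub>B\<^esub> (2::nat)) \<otimes>\<^bsub>B\<^esub> k = f a \<otimes>\<^bsub>B\<^esub> (f a \<otimes>\<^bsub>B\<^esub> k)" if "k \<in> J" for k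
    using a J.Icarr[OF that] by (simp add: numeral_2_eq_2 S.m_assoc)
  have 1: "(f a [^]\<^bsub>B\<^esub> (2::nat)) <#\<^bsub>B\<^esub> J = {f a \<otimes>\<^bsub>B\<^esub> (f a \<otimes>\<^bsub>B\<^esub> k) | k. k \<in> J}"
    by (auto simp: l_coset_def sq)
  have 2: "f a <#\<^bsub>B\<^esub> J = {f a \<otimes>\<^bsub>B\<^esub> k | k. k \<in> J}"
    by (auto simp: l_coset_def)
  have "f a \<otimes>\<^bsub>B\<^esub> k \<in> J" if "k \<in> J" for k using a that by (simp add: J.I_l_closed)
  then have "{f a \<otimes>\<^bsub>B\<^esub> (f a \<otimes>\<^bsub>B\<^esub> k) | k. k \<in> J} \<subseteq> {f a \<otimes>\<^bsub>B\<^esub> k | k. k \<in> J}" by blast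
  then show ?thesis unfolding 1 2 by blast
qed

text \<open>Outside \<open>m\<close> the element \<open>a\<close> has an inverse \<open>c\<close>,
  and f(c) j can be taken for \<open>k\<close>.\<close>

lemma absorb_extend:
  assumes unit: "carrier A - m \<subseteq> Units A"
    and absorb: "\<And>a j. \<lbrakk>a \<in> m; j \<in> J\<rbrakk> \<Longrightarrow> \<exists>k\<in>J. f a \<otimes>\<^bsub>B\<^esub> j = f a \<otimes>\<^bsub>B\<^esub> (f a \<otimes>\<^bsub>B\<^esub> k)"
    and a: "a \<in> carrier A" and j: "j \<in> J"
  shows "\<exists>k\<in>J. f a \<otimes>\<^bsub>B\<^esub> j = f a \<otimes>\<^bsub>B\<^esub> (f a \<otimes>\<^bsub>B\<^esub> k)"
proof (cases "a \<in> m")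
  case False
  then obtain c where c: "c \<in> carrier A" "a \<otimes>\<^bsub>A\<^esub> c = \<one>\<^bsub>A\<^esub>" using unit a by (auto simp: Units_def)
  then have "f a \<otimes>\<^bsub>B\<^esub> f c = \<one>\<^bsub>B\<^esub>" using a by (simp flip: hom_mult)
  then have "f a \<otimes>\<^bsub>B\<^esub> (f c \<otimes>\<^bsub>B\<^esub> j) = j" using a c J.Icarr[OF j] by (simp flip: S.m_assoc)
  moreover have "f c \<otimes>\<^bsub>B\<^esub> j \<in> J" using c j by (simp add: J.I_l_closed)
  ultimately show ?thesis by metis
qed (use absorb j in blast)

end

section \<open>The bi-amalgamation as a ring of pairs\<close>

lemma RDirProd_simps [simp]:
  "(x, y) \<otimes>\<^bsub>RDirProd B C\<^esub> (x', y') = (x \<otimes>\<^bsub>B\<^esub> x', y \<otimes>\<^bsub>C\<^esub> y')"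
  "(x, y) \<oplus>\<^bsub>RDirProd B C\<^esub> (x', y') = (x \<oplus>\<^bsub>B\<^esub> x', y \<oplus>\<^bsub>C\<^esub> y')"
  "\<one>\<^bsub>RDirProd B C\<^esub> = (\<one>\<^bsub>B\<^esub>, \<one>\<^bsub>C\<^esub>)" "\<zero>\<^bsub>RDirProd B C\<^esub> = (\<zero>\<^bsub>B\<^esub>, \<zero>\<^bsub>C\<^esub>)"
  by (simp_all add: RDirProd_def DirProd_def monoid.defs)

lemma bi_amalgamation_simps [simp]:
  "(x, y) \<otimes>\<^bsub>bi_amalgamation A B C f g J J'\<^esub> (x', y') = (x \<otimes>\<^bsub>B\<^esub> x', y \<otimes>\<^bsub>C\<^esub> y')"
  "(x, y) \<oplus>\<^bsub>bi_amalgamation A B C f g J J'\<^esub> (x', y') = (x \<oplus>\<^bsub>B\<^esub> x', y \<oplus>\<^bsub>C\<^esub> y')"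
  "\<one>\<^bsub>bi_amalgamation A B C f g J J'\<^esub> = (\<one>\<^bsub>B\<^esub>, \<one>\<^bsub>C\<^esub>)"
  "\<zero>\<^bsub>bi_amalgamation A B C f g J J'\<^esub> = (\<zero>\<^bsub>B\<^esub>, \<zero>\<^bsub>C\<^esub>)"
  by (simp_all add: bi_amalgamation_def)

locale bi_amalg = f: hom_ideal A B f J + g: hom_ideal A C g J'
  for A :: "('a, 'k) ring_scheme" and B :: "('b, 'l) ring_scheme" and C :: "('c, 'n) ring_scheme"
    and f :: "'a \<Rightarrow> 'b" and g :: "'a \<Rightarrow> 'c" and J :: "'b set" and J' :: "'c set" +
  assumes preimage: "a \<in> carrier A \<Longrightarrow> f a \<in> J \<longleftrightarrow> g a \<in> J'"
begin

abbreviation "T \<equiv> bi_amalgamation A B C f g J J'"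

lemma carrier_T: "carrier T = {(x, y). \<exists>a. f.over a x \<and> g.over a y}"
  by (auto simp: bi_amalgamation_def f.over_iff g.over_iff)

lemma cring_T: "cring T"
proof -
  let ?P = "RDirProd B C"
  interpret P: ring ?P
    using f.S.ring_axioms g.S.ring_axioms by (rule RDirProd_ring)
  have "comm_monoid ?P"
    by (rule P.monoid_comm_monoidI) (auto simp: RDirProd_carrier f.S.m_comm g.S.m_comm)
  then interpret P: cring ?P by (simp add: cring.intro P.ring_axioms)
  let ?H = "{(x, y). \<exists>a. f.over a x \<and> g.over a y}"
  have H: "?H \<subseteq> carrier ?P"
    using f.over_carrier g.over_carrier by (auto simp: RDirProd_carrier)
  have inv: "\<ominus>\<^bsub>?P\<^esub> (x, y) = (\<ominus>\<^bsub>B\<^esub> x, \<ominus>\<^bsub>C\<^esub> y)" if "x \<in> carrier B" "y \<in> carrier C" for x y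
    using that by (intro P.minus_equality) (auto simp: RDirProd_carrier f.S.l_neg g.S.l_neg)
  have "subring ?H ?P"
  proof (rule P.subringI[OF H])
    show "\<one>\<^bsub>?P\<^esub> \<in> ?H" using f.over_one g.over_one by auto
    show "\<ominus>\<^bsub>?P\<^esub> h \<in> ?H" if "h \<in> ?H" for h
      using that f.over_carrier g.over_carrier f.over_a_inv g.over_a_inv by (auto simp: inv) blast
    show "h \<otimes>\<^bsub>?P\<^esub> h' \<in> ?H" if "h \<in> ?H" "h' \<in> ?H" for h h'
      using that f.over_mult g.over_mult by auto blast
    show "h \<oplus>\<^bsub>?P\<^esub> h' \<in> ?H" if "h \<in> ?H" "h' \<in> ?H" for h h'
      using that f.over_add g.over_add by auto blast
  qed
  then have "cring (?P\<lparr>carrier := ?H\<rparr>)"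
    using P.subcring_iff[OF H] P.subcringI' by simp
  then show ?thesis
    using carrier_T by (simp add: bi_amalgamation_def)
qed

sublocale T: cring T by (rule cring_T)

lemma T_minus:
  assumes "(x, y) \<in> carrier T" "(x', y') \<in> carrier T"
  shows "(x, y) \<ominus>\<^bsub>T\<^esub> (x', y') = (x \<ominus>\<^bsub>B\<^esub> x', y \<ominus>\<^bsub>C\<^esub> y')"
proof -
  have "(\<ominus>\<^bsub>B\<^esub> x', \<ominus>\<^bsub>C\<^esub> y') \<in> carrier T"
    using assms(2) f.over_a_inv g.over_a_inv by (auto simp: carrier_T) blast
  moreover have "x' \<in> carrier B" "y' \<in> carrier C"
    using assms(2) f.over_carrier g.over_carrier by (auto simp: carrier_T)
  ultimately have "\<ominus>\<^bsub>T\<^esub> (x', y') = (\<ominus>\<^bsub>B\<^esub> x', \<ominus>\<^bsub>C\<^esub> y')"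
    using assms(2) by (intro T.minus_equality) (auto simp: f.S.l_neg g.S.l_neg)
  then show ?thesis by (simp add: a_minus_def)
qed

text \<open>The conditions separate into coordinates, but the two multipliers remain linked: they
  must lie over the same \<open>c\<close>.\<close>

lemma dominates_T_iff:
  assumes X: "(x, y) \<in> carrier T" and X': "(x', y') \<in> carrier T"
  shows "dominates T (x, y) (x', y') \<longleftrightarrow> (\<exists>c v w. f.over c v \<and> g.over c w \<and>
    x \<otimes>\<^bsub>B\<^esub> (x' \<ominus>\<^bsub>B\<^esub> x \<otimes>\<^bsub>B\<^esub> v) = \<zero>\<^bsub>B\<^esub> \<and>
    (x' \<ominus>\<^bsub>B\<^esub> x \<otimes>\<^bsub>B\<^esub> v) \<otimes>\<^bsub>B\<^esub> (x' \<ominus>\<^bsub>B\<^esub> x \<otimes>\<^bsub>B\<^esub> v) = \<zero>\<^bsub>B\<^esub> \<and>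
    y \<otimes>\<^bsub>C\<^esub> (y' \<ominus>\<^bsub>C\<^esub> y \<otimes>\<^bsub>C\<^esub> w) = \<zero>\<^bsub>C\<^esub> \<and>
    (y' \<ominus>\<^bsub>C\<^esub> y \<otimes>\<^bsub>C\<^esub> w) \<otimes>\<^bsub>C\<^esub> (y' \<ominus>\<^bsub>C\<^esub> y \<otimes>\<^bsub>C\<^esub> w) = \<zero>\<^bsub>C\<^esub>)" (is "_ \<longleftrightarrow> ?rhs")
proof -
  have minus: "(x', y') \<ominus>\<^bsub>T\<^esub> (x \<otimes>\<^bsub>B\<^esub> v, y \<otimes>\<^bsub>C\<^esub> w) = (x' \<ominus>\<^bsub>B\<^esub> x \<otimes>\<^bsub>B\<^esub> v, y' \<ominus>\<^bsub>C\<^esub> y \<otimes>\<^bsub>C\<^esub> w)"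
    if "(v, w) \<in> carrier T" for v w
    using T_minus[OF X', of "x \<otimes>\<^bsub>B\<^esub> v" "y \<otimes>\<^bsub>C\<^esub> w"] T.m_closed[OF X that] by simp
  have "dominates T (x, y) (x', y') \<longleftrightarrow> (\<exists>v w. (v, w) \<in> carrier T \<and>
    (x, y) \<otimes>\<^bsub>T\<^esub> ((x', y') \<ominus>\<^bsub>T\<^esub> (x, y) \<otimes>\<^bsub>T\<^esub> (v, w)) = \<zero>\<^bsub>T\<^esub> \<and>
    ((x', y') \<ominus>\<^bsub>T\<^esub> (x, y) \<otimes>\<^bsub>T\<^esub> (v, w)) \<otimes>\<^bsub>T\<^esub> ((x', y') \<ominus>\<^bsub>T\<^esub> (x, y) \<otimes>\<^bsub>T\<^esub> (v, w)) = \<zero>\<^bsub>T\<^esub>)"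
    unfolding dominates_def by (simp only: Bex_def split_paired_Ex)
  also have "\<dots> \<longleftrightarrow> (\<exists>v w. (v, w) \<in> carrier T \<and>
    x \<otimes>\<^bsub>B\<^esub> (x' \<ominus>\<^bsub>B\<^esub> x \<otimes>\<^bsub>B\<^esub> v) = \<zero>\<^bsub>B\<^esub> \<and>
    (x' \<ominus>\<^bsub>B\<^esub> x \<otimes>\<^bsub>B\<^esub> v) \<otimes>\<^bsub>B\<^esub> (x' \<ominus>\<^bsub>B\<^esub> x \<otimes>\<^bsub>B\<^esub> v) = \<zero>\<^bsub>B\<^esub> \<and>
    y \<otimes>\<^bsub>C\<^esub> (y' \<ominus>\<^bsub>C\<^esub> y \<otimes>\<^bsub>C\<^esub> w) = \<zero>\<^bsub>C\<^esub> \<and>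
    (y' \<ominus>\<^bsub>C\<^esub> y \<otimes>\<^bsub>C\<^esub> w) \<otimes>\<^bsub>C\<^esub> (y' \<ominus>\<^bsub>C\<^esub> y \<otimes>\<^bsub>C\<^esub> w) = \<zero>\<^bsub>C\<^esub>)"
    by (rule ex_cong1, rule ex_cong1, rule conj_cong[OF refl]) (auto simp: minus)
  also have "\<dots> \<longleftrightarrow> ?rhs"
    unfolding carrier_T by auto
  finally show ?thesis .
qed

section \<open>The Gaussian property of the bi-amalgamation\<close>

text \<open>The first projection is surjective: an \<open>x\<close> over \<open>a\<close> is the
  image of \<open>(x, g a)\<close>.\<close>

lemma gaussian_image:
  assumes "gaussian_ring T"
  shows "gaussian_ring (image_plus_ideal A B f J)"
proof (rule gaussian_ring_surj_image[OF assms f.cring_image_plus_ideal])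
  show "fst \<in> ring_hom T (image_plus_ideal A B f J)"
    by (rule ring_hom_memI)
      (auto simp: carrier_T f.carrier_image_plus_ideal, auto simp: image_plus_ideal_def)
  show "fst ` carrier T = carrier (image_plus_ideal A B f J)"
  proof
    show "carrier (image_plus_ideal A B f J) \<subseteq> fst ` carrier T"
    proof
      fix x assume "x \<in> carrier (image_plus_ideal A B f J)"
      then obtain a where "f.over a x" by (auto simp: f.carrier_image_plus_ideal)
      then have "(x, g a) \<in> carrier T"
        using f.over_carrier g.over_hom by (auto simp: carrier_T)
      then show "x \<in> fst ` carrier T" by force
    qed
  qed (auto simp: carrier_T f.carrier_image_plus_ideal)
qed

lemma swap: "bi_amalg A C B g f J' J"
  by (simp add: bi_amalg_def bi_amalg_axioms_def preimage f.hom_ideal_axioms g.hom_ideal_axioms)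

text \<open>Makes every result about \<open>B\<close> and \<open>J\<close> available for
  \<open>C\<close> and \<open>J'\<close>.\<close>

lemma gaussian_swap:
  assumes "gaussian_ring T"
  shows "gaussian_ring (bi_amalgamation A C B g f J' J)"
proof -
  interpret s: bi_amalg A C B g f J' J by (rule swap)
  show ?thesis
  proof (rule gaussian_ring_surj_image[OF assms s.cring_T])
    show "prod.swap \<in> ring_hom T (bi_amalgamation A C B g f J' J)"
      by (rule ring_hom_memI) (auto simp: carrier_T s.carrier_T)
    show "prod.swap ` carrier T = carrier (bi_amalgamation A C B g f J' J)"
      by (auto simp: carrier_T s.carrier_T image_iff)
  qed
qed

text \<open>Two pairs over \<open>a\<close> and \<open>b\<close> are compared as \<open>a\<close>
  and \<open>b\<close> are in \<open>A\<close>: one multiplier \<open>v\<close> in \<open>A\<close>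
  is lifted to each component separately.\<close>

lemma gaussian_if_absorb:
  assumes gauss: "gaussian_ring A"
    and m: "ideal m A" "\<one>\<^bsub>A\<^esub> \<notin> m" "carrier A - m \<subseteq> Units A"
    and J2: "\<And>j k. \<lbrakk>j \<in> J; k \<in> J\<rbrakk> \<Longrightarrow> j \<otimes>\<^bsub>B\<^esub> k = \<zero>\<^bsub>B\<^esub>"
    and J'2: "\<And>j k. \<lbrakk>j \<in> J'; k \<in> J'\<rbrakk> \<Longrightarrow> j \<otimes>\<^bsub>C\<^esub> k = \<zero>\<^bsub>C\<^esub>"
    and absorb: "\<And>a j. \<lbrakk>a \<in> m; j \<in> J\<rbrakk> \<Longrightarrow> \<exists>k\<in>J. f a \<otimes>\<^bsub>B\<^esub> j = f a \<otimes>\<^bsub>B\<^esub> (f a \<otimes>\<^bsub>B\<^esub> k)"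
    and absorb': "\<And>a j. \<lbrakk>a \<in> m; j \<in> J'\<rbrakk> \<Longrightarrow> \<exists>k\<in>J'. g a \<otimes>\<^bsub>C\<^esub> j = g a \<otimes>\<^bsub>C\<^esub> (g a \<otimes>\<^bsub>C\<^esub> k)"
  shows "gaussian_ring T"
proof (rule T.gaussian_if_dominates)
  have dom: "dominates T (x, y) (x', y')"
    if ab: "dominates A a b" and x: "f.over a x" "g.over a y" and x': "f.over b x'" "g.over b y'"
    for a b x y x' y'
  proof -
    obtain v where v: "v \<in> carrier A" and ad: "a \<otimes>\<^bsub>A\<^esub> (b \<ominus>\<^bsub>A\<^esub> a \<otimes>\<^bsub>A\<^esub> v) = \<zero>\<^bsub>A\<^esub>"
      and dd: "(b \<ominus>\<^bsub>A\<^esub> a \<otimes>\<^bsub>A\<^esub> v) \<otimes>\<^bsub>A\<^esub> (b \<ominus>\<^bsub>A\<^esub> a \<otimes>\<^bsub>A\<^esub> v) = \<zero>\<^bsub>A\<^esub>"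
      using ab by (auto simp: dominates_def)
    obtain p where p: "f.over v p" "x \<otimes>\<^bsub>B\<^esub> (x' \<ominus>\<^bsub>B\<^esub> x \<otimes>\<^bsub>B\<^esub> p) = \<zero>\<^bsub>B\<^esub>"
      "(x' \<ominus>\<^bsub>B\<^esub> x \<otimes>\<^bsub>B\<^esub> p) \<otimes>\<^bsub>B\<^esub> (x' \<ominus>\<^bsub>B\<^esub> x \<otimes>\<^bsub>B\<^esub> p) = \<zero>\<^bsub>B\<^esub>"
      using f.dominates_lift[OF J2 f.absorb_extend[OF m(3) absorb] x(1) x'(1) v ad dd] by blast
    obtain q where q: "g.over v q" "y \<otimes>\<^bsub>C\<^esub> (y' \<ominus>\<^bsub>C\<^esub> y \<otimes>\<^bsub>C\<^esub> q) = \<zero>\<^bsub>C\<^esub>"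
      "(y' \<ominus>\<^bsub>C\<^esub> y \<otimes>\<^bsub>C\<^esub> q) \<otimes>\<^bsub>C\<^esub> (y' \<ominus>\<^bsub>C\<^esub> y \<otimes>\<^bsub>C\<^esub> q) = \<zero>\<^bsub>C\<^esub>"
      using g.dominates_lift[OF J'2 g.absorb_extend[OF m(3) absorb'] x(2) x'(2) v ad dd] by blast
    have "(x, y) \<in> carrier T" "(x', y') \<in> carrier T" using x x' by (auto simp: carrier_T)
    from dominates_T_iff[OF this] show ?thesis
      by (rule iffD2) (intro exI[of _ v] exI[of _ p] exI[of _ q] conjI p q)
  qed
  fix X Y assume "X \<in> carrier T" "Y \<in> carrier T"
  then obtain a x y b x' y' where X: "X = (x, y)" "f.over a x" "g.over a y"
    and Y: "Y = (x', y')" "f.over b x'" "g.over b y'"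
    by (auto simp: carrier_T)
  have "dominates A a b \<or> dominates A b a"
    using X Y f.over_carrier by (intro f.R.local_gaussian_dominates[OF gauss m]) auto
  then show "dominates T X Y \<or> dominates T Y X"
    unfolding X(1) Y(1) using dom[OF _ X(2,3) Y(2,3)] dom[OF _ Y(2,3) X(2,3)] by (elim disjE) simp_all
qed

lemma absorb_if_gaussian:
  assumes gauss: "gaussian_ring T"
    and m: "ideal m A" "\<one>\<^bsub>A\<^esub> \<notin> m" "carrier A - m \<subseteq> Units A"
    and proper: "J \<noteq> carrier B"
    and J2: "\<And>j k. \<lbrakk>j \<in> J; k \<in> J\<rbrakk> \<Longrightarrow> j \<otimes>\<^bsub>B\<^esub> k = \<zero>\<^bsub>B\<^esub>"
    and J'2: "\<And>j k. \<lbrakk>j \<in> J'; k \<in> J'\<rbrakk> \<Longrightarrow> j \<otimes>\<^bsub>C\<^esub> k = \<zero>\<^bsub>C\<^esub>"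
    and prime: "primeideal {a \<in> carrier A. f a \<in> J} A"
    and a: "a \<in> carrier A" and j: "j \<in> J"
  shows "\<exists>k\<in>J. f a \<otimes>\<^bsub>B\<^esub> j = f a \<otimes>\<^bsub>B\<^esub> (f a \<otimes>\<^bsub>B\<^esub> k)"
proof -
  interpret m: ideal m A by (rule m(1))
  let ?I = "{a \<in> carrier A. f a \<in> J}"
  \<comment> \<open>\<open>N\<close> is the maximal ideal of the bi-amalgamation.\<close>
  define N where "N = {(x, y). \<exists>a\<in>m. f.over a x \<and> g.over a y}"
  \<comment> \<open>If some such \<open>b\<close> were a unit of \<open>A\<close>, then
    \<open>J\<close> would contain a unit and be all of \<open>B\<close>.\<close>
  have kernel: "b \<in> m" if b: "b \<in> carrier A" "f b \<in> J" for b
  proof (rule ccontr)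
    assume "b \<notin> m"
    then obtain c where c: "c \<in> carrier A" "c \<otimes>\<^bsub>A\<^esub> b = \<one>\<^bsub>A\<^esub>" using m(3) b by (auto simp: Units_def)
    then have "f c \<otimes>\<^bsub>B\<^esub> f b = \<one>\<^bsub>B\<^esub>" using b by (simp flip: f.hom_mult)
    then have "\<one>\<^bsub>B\<^esub> \<in> J" using f.J.I_l_closed[OF b(2), of "f c"] c by simp
    then show False using proper f.J.one_imp_carrier by blast
  qed
  have N: "ideal N T"
  proof (rule T.ideal_criterion)
    show "N \<subseteq> carrier T" by (auto simp: N_def carrier_T)
    have "(\<zero>\<^bsub>B\<^esub>, \<zero>\<^bsub>C\<^esub>) \<in> N"
      using f.over_ideal g.over_ideal by (auto simp: N_def intro!: bexI[of _ "\<zero>\<^bsub>A\<^esub>"])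
    then show "N \<noteq> {}" by blast
    show "X \<oplus>\<^bsub>T\<^esub> Y \<in> N" if "X \<in> N" "Y \<in> N" for X Y
      using that f.over_add g.over_add m.a_closed by (auto simp: N_def) blast
    show "R \<otimes>\<^bsub>T\<^esub> X \<in> N" if "R \<in> carrier T" "X \<in> N" for R X
    proof -
      obtain a x y where X: "X = (x, y)" "a \<in> m" "f.over a x" "g.over a y"
        using \<open>X \<in> N\<close> by (auto simp: N_def)
      obtain b u w where R: "R = (u, w)" "f.over b u" "g.over b w"
        using \<open>R \<in> carrier T\<close> by (auto simp: carrier_T)
      have "b \<otimes>\<^bsub>A\<^esub> a \<in> m" using X R f.over_carrier m.I_l_closed by blast
      then show ?thesis
        using X(1) R(1) f.over_mult[OF R(2) X(3)] g.over_mult[OF R(3) X(4)] by (auto simp: N_def)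
    qed
  qed
  \<comment> \<open>If \<one> lay over some \<open>a\<close> in \<open>m\<close>, then 1 - a would
    map into \<open>J\<close> and lie in \<open>m\<close>, so \<one> would be in
    \<open>m\<close>.\<close>
  have one: "\<one>\<^bsub>T\<^esub> \<notin> N"
  proof
    assume "\<one>\<^bsub>T\<^esub> \<in> N"
    then obtain a where a: "a \<in> m" "f.over a \<one>\<^bsub>B\<^esub>" by (auto simp: N_def)
    have ac: "a \<in> carrier A" using a m.Icarr by blast
    have "f (\<one>\<^bsub>A\<^esub> \<ominus>\<^bsub>A\<^esub> a) \<in> J" using a ac by (simp add: lies_over_def a_minus_def)
    then have "\<one>\<^bsub>A\<^esub> \<ominus>\<^bsub>A\<^esub> a \<in> m" using ac by (intro kernel) simp_all
    then have "(\<one>\<^bsub>A\<^esub> \<ominus>\<^bsub>A\<^esub> a) \<oplus>\<^bsub>A\<^esub> a \<in> m" using a by simp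
    then show False using m(2) ac by (simp add: a_minus_def f.R.a_assoc f.R.l_neg)
  qed
  \<comment> \<open>Both components are inverted over the same \<open>c\<close>, so the inverses
    form an element of the bi-amalgamation.\<close>
  have units: "carrier T - N \<subseteq> Units T"
  proof
    fix X assume X: "X \<in> carrier T - N"
    then obtain a x y where x: "X = (x, y)" "f.over a x" "g.over a y" by (auto simp: carrier_T)
    then have "a \<in> carrier A - m" using X f.over_carrier by (auto simp: N_def)
    then obtain c where c: "c \<in> carrier A" "a \<otimes>\<^bsub>A\<^esub> c = \<one>\<^bsub>A\<^esub>" using m(3) by (auto simp: Units_def)
    obtain x' where x': "f.over c x'" "x \<otimes>\<^bsub>B\<^esub> x' = \<one>\<^bsub>B\<^esub>" using f.over_inverse[OF J2 x(2) c] .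
    obtain y' where y': "g.over c y'" "y \<otimes>\<^bsub>C\<^esub> y' = \<one>\<^bsub>C\<^esub>" using g.over_inverse[OF J'2 x(3) c] .
    have X': "(x', y') \<in> carrier T" using x' y' by (auto simp: carrier_T)
    have "X \<otimes>\<^bsub>T\<^esub> (x', y') = \<one>\<^bsub>T\<^esub>" using x x' y' by simp
    moreover from this have "(x', y') \<otimes>\<^bsub>T\<^esub> X = \<one>\<^bsub>T\<^esub>" using T.m_comm[of "(x', y')" X] X X' by auto
    ultimately show "X \<in> Units T" using X X' unfolding Units_def by blast
  qed
  note dom = T.local_gaussian_dominates[OF gauss N one units]
  have jc: "j \<in> carrier B" using j f.J.Icarr by blast
  have X: "(f a, g a) \<in> carrier T" using f.over_hom[OF a] g.over_hom[OF a] by (auto simp: carrier_T)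
  have Y: "(j, \<zero>\<^bsub>C\<^esub>) \<in> carrier T"
    using f.over_ideal[OF j] g.over_ideal[OF g.J.zero_closed] by (auto simp: carrier_T)
  have fa: "f a \<in> carrier B" "g a \<in> carrier C" using a by simp_all
  show ?thesis
    using dom[OF X Y]
  proof
    assume "dominates T (f a, g a) (j, \<zero>\<^bsub>C\<^esub>)"
    then obtain c v w where v: "f.over c v" and w: "g.over c w"
      and 1: "f a \<otimes>\<^bsub>B\<^esub> (j \<ominus>\<^bsub>B\<^esub> f a \<otimes>\<^bsub>B\<^esub> v) = \<zero>\<^bsub>B\<^esub>"
      and 2: "g a \<otimes>\<^bsub>C\<^esub> (\<zero>\<^bsub>C\<^esub> \<ominus>\<^bsub>C\<^esub> g a \<otimes>\<^bsub>C\<^esub> w) = \<zero>\<^bsub>C\<^esub>"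
      unfolding dominates_T_iff[OF X Y] by blast
    have c: "c \<in> carrier A" and vc: "v \<in> carrier B" and wc: "w \<in> carrier C"
      using v w f.over_carrier g.over_carrier by blast+
    have eq: "f a \<otimes>\<^bsub>B\<^esub> j = f a \<otimes>\<^bsub>B\<^esub> (f a \<otimes>\<^bsub>B\<^esub> v)"
      using 1 fa jc vc by (simp add: f.S.mult_minus_simps f.S.minus_eq_iff)
    have "g a \<otimes>\<^bsub>C\<^esub> (g a \<otimes>\<^bsub>C\<^esub> w) = \<zero>\<^bsub>C\<^esub>"
      using 2 fa wc by (simp add: a_minus_def g.S.r_minus)
    \<comment> \<open>The element g(a)^2 w is zero and lies over a^2 c, so a^2 c is in the common
      preimage. If \<open>c\<close> is in it, then \<open>v\<close> is in \<open>J\<close> and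
      serves as \<open>k\<close>; if \<open>a\<close> is, then f(a) j = 0.\<close>
    then have "a \<otimes>\<^bsub>A\<^esub> (a \<otimes>\<^bsub>A\<^esub> c) \<in> ?I"
      using g.mem_ideal_iff[OF g.over_mult[OF g.over_hom[OF a] g.over_mult[OF g.over_hom[OF a] w]]]
        preimage[of "a \<otimes>\<^bsub>A\<^esub> (a \<otimes>\<^bsub>A\<^esub> c)"] a c g.J.zero_closed by auto
    then have "a \<in> ?I \<or> c \<in> ?I"
      using primeideal.I_prime[OF prime, of a "a \<otimes>\<^bsub>A\<^esub> c"] primeideal.I_prime[OF prime, of a c] a c by auto
    then show ?thesis
    proof
      assume "c \<in> ?I"
      then show ?thesis using eq f.mem_ideal_iff[OF v] by blast
    next
      assume "a \<in> ?I"
      then have "f a \<otimes>\<^bsub>B\<^esub> j = \<zero>\<^bsub>B\<^esub>" using J2 j by simp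
      then show ?thesis using fa by (intro bexI[of _ "\<zero>\<^bsub>B\<^esub>"]) simp_all
    qed
  next
    \<comment> \<open>Here j^2 = 0 leaves j f(a) = 0, so k = 0 works.\<close>
    assume "dominates T (j, \<zero>\<^bsub>C\<^esub>) (f a, g a)"
    then obtain v where vc: "v \<in> carrier B" and 1: "j \<otimes>\<^bsub>B\<^esub> (f a \<ominus>\<^bsub>B\<^esub> j \<otimes>\<^bsub>B\<^esub> v) = \<zero>\<^bsub>B\<^esub>"
      unfolding dominates_T_iff[OF Y X] using f.over_carrier by blast
    have "j \<otimes>\<^bsub>B\<^esub> (j \<otimes>\<^bsub>B\<^esub> v) = \<zero>\<^bsub>B\<^esub>" using J2[OF j j] jc vc by (simp flip: f.S.m_assoc)
    then have "j \<otimes>\<^bsub>B\<^esub> f a = \<zero>\<^bsub>B\<^esub>"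
      using 1 fa jc vc by (simp add: a_minus_def f.S.r_distr f.S.r_minus)
    then show ?thesis using fa jc f.S.m_comm[of j "f a"] by (intro bexI[of _ "\<zero>\<^bsub>B\<^esub>"]) simp_all
  qed
qed

end

theorem proposition2p4:
  fixes A :: "('a, 'k) ring_scheme"
    and B :: "('b, 'l) ring_scheme"
    and C :: "('c, 'n) ring_scheme"
    and f :: "'a \<Rightarrow> 'b" and g :: "'a \<Rightarrow> 'c"
    and J :: "'b set" and J' :: "'c set" and I0 m :: "'a set"
  assumes "cring A" and "cring B" and "cring C"
    and "f \<in> ring_hom A B" and "g \<in> ring_hom A C"
    and "ideal J B" and "ideal J' C"
    and "{a \<in> carrier A. f a \<in> J} = I0" and "{a \<in> carrier A. g a \<in> J'} = I0"
    and "local_ring A" and "maximalideal m A"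
    and "J \<noteq> {\<zero>\<^bsub>B\<^esub>}" and "J \<noteq> carrier B"
    and "J' \<noteq> {\<zero>\<^bsub>C\<^esub>}" and "J' \<noteq> carrier C"
    and "J \<times> J' \<subseteq> Jac (RDirProd B C)"
  shows
    "(gaussian_ring (bi_amalgamation A B C f g J J') \<longrightarrow>
        gaussian_ring (image_plus_ideal A B f J) \<and> gaussian_ring (image_plus_ideal A C g J'))
     \<and>
     (gaussian_ring A \<and>
      gaussian_ring (image_plus_ideal A B f J) \<and> gaussian_ring (image_plus_ideal A C g J') \<and>
      ideal_prod B J J = {\<zero>\<^bsub>B\<^esub>} \<and> ideal_prod C J' J' = {\<zero>\<^bsub>C\<^esub>} \<and>
      (\<forall>a\<in>m. f a <#\<^bsub>B\<^esub> J = (f a [^]\<^bsub>B\<^esub> (2::nat)) <#\<^bsub>B\<^esub> J \<and>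
              g a <#\<^bsub>C\<^esub> J' = (g a [^]\<^bsub>C\<^esub> (2::nat)) <#\<^bsub>C\<^esub> J')
      \<longrightarrow> gaussian_ring (bi_amalgamation A B C f g J J'))
     \<and>
     (gaussian_ring A \<and>
      ideal_prod B J J = {\<zero>\<^bsub>B\<^esub>} \<and> ideal_prod C J' J' = {\<zero>\<^bsub>C\<^esub>} \<and> primeideal I0 A
      \<longrightarrow>
      (gaussian_ring (bi_amalgamation A B C f g J J') \<longleftrightarrow>
        gaussian_ring (image_plus_ideal A B f J) \<and> gaussian_ring (image_plus_ideal A C g J') \<and>
        (\<forall>a\<in>m. f a <#\<^bsub>B\<^esub> J = (f a [^]\<^bsub>B\<^esub> (2::nat)) <#\<^bsub>B\<^esub> J \<and>
                g a <#\<^bsub>C\<^esub> J' = (g a [^]\<^bsub>C\<^esub> (2::nat)) <#\<^bsub>C\<^esub> J')))"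
proof -
  interpret A: local_ring A by fact
  interpret m: maximalideal m A by fact
  interpret bi_amalg A B C f g J J'
  proof (intro bi_amalg.intro hom_ideal.intro bi_amalg_axioms.intro)
    show "ring_hom_cring A B f" "ring_hom_cring A C g"
      using assms by (simp_all add: ring_hom_cring_def ring_hom_cring_axioms_def)
    show "f a \<in> J \<longleftrightarrow> g a \<in> J'" if "a \<in> carrier A" for a
      using assms(8,9) that by blast
  qed fact+
  interpret s: bi_amalg A C B g f J' J by (rule swap)
  let ?absorb = "\<forall>a\<in>m. f a <#\<^bsub>B\<^esub> J = (f a [^]\<^bsub>B\<^esub> (2::nat)) <#\<^bsub>B\<^esub> J \<and>
    g a <#\<^bsub>C\<^esub> J' = (g a [^]\<^bsub>C\<^esub> (2::nat)) <#\<^bsub>C\<^esub> J'"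
  have m: "ideal m A" "\<one>\<^bsub>A\<^esub> \<notin> m" "carrier A - m \<subseteq> Units A"
    using m.is_ideal m.one_imp_carrier m.I_notcarr
      A.Units_if_notin_maximalideal[OF assms(11)] by auto
  have absorb: "?absorb \<longleftrightarrow> (\<forall>a\<in>m.
    (\<forall>j\<in>J. \<exists>k\<in>J. f a \<otimes>\<^bsub>B\<^esub> j = f a \<otimes>\<^bsub>B\<^esub> (f a \<otimes>\<^bsub>B\<^esub> k)) \<and>
    (\<forall>j\<in>J'. \<exists>k\<in>J'. g a \<otimes>\<^bsub>C\<^esub> j = g a \<otimes>\<^bsub>C\<^esub> (g a \<otimes>\<^bsub>C\<^esub> k)))"
    using f.absorb_iff g.absorb_iff m.Icarr by simp
  have J2: "j \<otimes>\<^bsub>B\<^esub> k = \<zero>\<^bsub>B\<^esub>" if "ideal_prod B J J = {\<zero>\<^bsub>B\<^esub>}" "j \<in> J" "k \<in> J" for j k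
    using ideal_prod.prod[of j J k J B] that by simp
  have J'2: "j \<otimes>\<^bsub>C\<^esub> k = \<zero>\<^bsub>C\<^esub>" if "ideal_prod C J' J' = {\<zero>\<^bsub>C\<^esub>}" "j \<in> J'" "k \<in> J'" for j k
    using ideal_prod.prod[of j J' k J' C] that by simp
  have 1: "gaussian_ring (image_plus_ideal A B f J) \<and> gaussian_ring (image_plus_ideal A C g J')"
    if "gaussian_ring T"
    using gaussian_image[OF that] s.gaussian_image[OF gaussian_swap[OF that]] by blast
  have 2: "gaussian_ring T"
    if A: "gaussian_ring A" and B: "ideal_prod B J J = {\<zero>\<^bsub>B\<^esub>}" and C: "ideal_prod C J' J' = {\<zero>\<^bsub>C\<^esub>}"
      and ?absorb
    using \<open>?absorb\<close> unfolding absorb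
    by (intro gaussian_if_absorb[OF A m J2[OF B] J'2[OF C]]) auto
  have 3: ?absorb
    if T: "gaussian_ring T" and B: "ideal_prod B J J = {\<zero>\<^bsub>B\<^esub>}" and C: "ideal_prod C J' J' = {\<zero>\<^bsub>C\<^esub>}"
      and prime: "primeideal I0 A"
  proof -
    have p: "primeideal {a \<in> carrier A. f a \<in> J} A" "primeideal {a \<in> carrier A. g a \<in> J'} A"
      using prime assms(8,9) by simp_all
    \<comment> \<open>The condition on \<open>g\<close> and \<open>J'\<close> is the one on
      \<open>f\<close> and \<open>J\<close> for the bi-amalgamation with exchanged
      components.\<close>
    show ?thesis
      unfolding absorb
      by (intro ballI conjI absorb_if_gaussian[OF T m assms(13) J2[OF B] J'2[OF C] p(1)]
          s.absorb_if_gaussian[OF gaussian_swap[OF T] m assms(15) J'2[OF C] J2[OF B] p(2)] m.Icarr)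
  qed
  define P where "P \<longleftrightarrow> ?absorb"
  show ?thesis
    using 1 2 3 unfolding P_def[symmetric] by blast
qed

end
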